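(* Let $m\in\mathbb{N}$ and let $A\in\widetilde{\mathbb{C}}(n)^{m^2}$ be an $m\times m$ square matrix with entries from $\widetilde{\mathbb{C}}(n)$. The following are equivalent: (i) $A$ is non-degenerate, i.e., for $\xi\in\widetilde{\mathbb{C}}(n)^m$, if $\xi^tA\eta=0$ for all $\eta\in\widetilde{\mathbb{C}}(n)^m$ then $\xi=0$. (ii) $A:\widetilde{\mathbb{C}}(n)^m\to\widetilde{\mathbb{C}}(n)^m$ is injective. (iii) $A:\widetilde{\mathbb{C}}(n)^m\to\widetilde{\mathbb{C}}(n)^m$ is bijective. (iv) $\det(A)$ is invertible in $\widetilde{\mathbb{C}}(n)$.
   Context: $n\in\mathbb{N}=\{1,2,\dots\}$. For expressions defined for small $\varepsilon>0$, $f(\varepsilon)=O(g(\varepsilon))$ means $\exists C>0\ \exists\varepsilon_0>0\ \forall\varepsilon<\varepsilon_0$: $|f(\varepsilon)|<C|g(\varepsilon)|$. $\mathcal{D}(\mathbb{R}^n)$ is the space of smooth compactly supported (complex-valued) functions. For $q\in\mathbb{N}_0$, $\mathcal{A}_q(\mathbb{R}^n)$ is the set of $\varphi\in\mathcal{D}(\mathbb{R}^n)$ with $\int\varphi=1$ and $\int x^\alpha\varphi(x)\,dx=0$ for all multi-indices $\alpha$ with $1\le|\alpha|\le q$. For $\varepsilon>0$, $(S_\varepsilon\varphi)(y):=\varepsilon^{-n}\varphi(y/\varepsilon)$. $\mathbb{C}_M(n)$ is the set of $r:\mathcal{A}_0(\mathbb{R}^n)\to\mathbb{C}$ such that $\exists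 N\in\mathbb{N}\ \forall\varphi\in\mathcal{A}_N(\mathbb{R}^n)$: $|r(S_\varepsilon\varphi)|=O(\varepsilon^{-N})$; $\mathbb{C}_N(n)$ is the set of $r:\mathcal{A}_0(\mathbb{R}^n)\to\mathbb{C}$ such that $\forall m\in\mathbb{N}\ \exists q\in\mathbb{N}\ \forall\varphi\in\mathcal{A}_q(\mathbb{R}^n)$: $|r(S_\varepsilon\varphi)|=O(\varepsilon^m)$; $\widetilde{\mathbb{C}}(n):=\mathbb{C}_M(n)/\mathbb{C}_N(n)$, a commutative ring with pointwise operations. A matrix $A$ acts on $\widetilde{\mathbb{C}}(n)^m$ by $\eta\mapsto A\eta$. *)

theory Defs
  imports "HOL-Analysis.Analysis" "HOL-Library.Landau_Symbols"
begin

section \<open>Smooth functions and test functions\<close>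

fun k_times_cont_diff ::
    "nat \<Rightarrow> ('a::euclidean_space \<Rightarrow> 'b::real_normed_vector) \<Rightarrow> bool" where
  "k_times_cont_diff 0 f \<longleftrightarrow> continuous_on UNIV f"
| "k_times_cont_diff (Suc k) f \<longleftrightarrow>
     (\<forall>x. f differentiable (at x)) \<and>
     (\<forall>v. k_times_cont_diff k (\<lambda>x. frechet_derivative f (at x) v))"

definition smooth :: "('a::euclidean_space \<Rightarrow> 'b::real_normed_vector) \<Rightarrow> bool" where
  "smooth f \<longleftrightarrow> (\<forall>k. k_times_cont_diff k f)"

definition test_functions :: "(real ^ 'n::finite \<Rightarrow> complex) set" where
  "test_functions = {\<phi>. smooth \<phi> \<and> compact (closure {x. \<phi> x \<noteq> 0})}"

definition monomial :: "('n::finite \<Rightarrow> nat) \<Rightarrow> real ^ 'n \<Rightarrow> real" where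
  "monomial \<alpha> x = (\<Prod>i\<in>UNIV. (x $ i) ^ \<alpha> i)"

definition test_objects :: "nat \<Rightarrow> (real ^ 'n::finite \<Rightarrow> complex) set" where
  "test_objects q = {\<phi> \<in> test_functions.
     (LINT x|lborel. \<phi> x) = 1 \<and>
     (\<forall>\<alpha>. 1 \<le> (\<Sum>i\<in>UNIV. \<alpha> i) \<and> (\<Sum>i\<in>UNIV. \<alpha> i) \<le> q \<longrightarrow>
        (LINT x|lborel. monomial \<alpha> x *\<^sub>R \<phi> x) = 0)}"

definition scale_fun :: "real \<Rightarrow> (real ^ 'n::finite \<Rightarrow> complex) \<Rightarrow> real ^ 'n \<Rightarrow> complex" where
  "scale_fun \<epsilon> \<phi> = (\<lambda>y. \<phi> (y /\<^sub>R \<epsilon>) /\<^sub>R \<epsilon> ^ CARD('n))"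


section \<open>Moderate and negligible functions\<close>

text \<open>
  A function on \<open>test_objects 0\<close> is represented by a total function on \<open>real ^ 'n \<Rightarrow> complex\<close>.
  Its values outside \<open>test_objects 0\<close> are irrelevant: they enter neither of the following
  two definitions (see \<open>scale_fun_test_objects\<close>), and they are identified in the quotient
  (see \<open>colombeau_rel_cong\<close>).
\<close>

definition moderate :: "((real ^ 'n::finite \<Rightarrow> complex) \<Rightarrow> complex) set" where
  "moderate = {r. \<exists>N\<ge>1. \<forall>\<phi>\<in>test_objects N.
     (\<lambda>\<epsilon>::real. norm (r (scale_fun \<epsilon> \<phi>))) \<in> O[at_right 0](\<lambda>\<epsilon>. inverse (\<epsilon> ^ N))}"

definition null_functions :: "((real ^ 'n::finite \<Rightarrow> complex) \<Rightarrow> complex) set" where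
  "null_functions = {r. \<forall>m\<ge>1. \<exists>q\<ge>1. \<forall>\<phi>\<in>test_objects q.
     (\<lambda>\<epsilon>::real. norm (r (scale_fun \<epsilon> \<phi>))) \<in> O[at_right 0](\<lambda>\<epsilon>. \<epsilon> ^ m)}"

definition colombeau_rel ::
    "((real ^ 'n::finite \<Rightarrow> complex) \<Rightarrow> complex) \<Rightarrow> ((real ^ 'n \<Rightarrow> complex) \<Rightarrow> complex) \<Rightarrow> bool" where
  "colombeau_rel r s \<longleftrightarrow> r \<in> moderate \<and> s \<in> moderate \<and> (\<lambda>\<phi>. r \<phi> - s \<phi>) \<in> null_functions"


section \<open>Existence of test objects\<close>

lemma k_times_cont_diff_SucI:
  assumes "\<And>x. (f has_derivative f' x) (at x)"
    and "\<And>v. k_times_cont_diff k (\<lambda>x. f' x v)"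
  shows "k_times_cont_diff (Suc k) f"
proof -
  have "frechet_derivative f (at x) = f' x" for x
    using frechet_derivative_at[OF assms(1)] by simp
  then show ?thesis
    using assms by (auto simp: differentiable_def)
qed

lemma k_times_cont_diff_SucD: "k_times_cont_diff (Suc k) f \<Longrightarrow> k_times_cont_diff k f"
proof (induction k arbitrary: f)
  case 0
  then show ?case
    by (auto intro!: continuous_at_imp_continuous_on differentiable_imp_continuous_within)
next
  case (Suc k)
  then show ?case by (metis k_times_cont_diff.simps(2))
qed

lemma k_times_cont_diff_const: "k_times_cont_diff k (\<lambda>_. c)"
  by (induction k arbitrary: c) auto

lemma k_times_cont_diff_linear:
  assumes "bounded_linear f" shows "k_times_cont_diff k f"
proof (cases k)
  case 0
  then show ?thesis using assms by (simp add: linear_continuous_on)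
next
  case (Suc j)
  show ?thesis unfolding Suc
    by (rule k_times_cont_diff_SucI[where f' = "\<lambda>_. f"])
       (auto intro: bounded_linear_imp_has_derivative assms k_times_cont_diff_const)
qed

lemma k_times_cont_diff_add:
  "k_times_cont_diff k f \<Longrightarrow> k_times_cont_diff k g \<Longrightarrow> k_times_cont_diff k (\<lambda>x. f x + g x)"
proof (induction k arbitrary: f g)
  case 0
  then show ?case by (auto intro: continuous_on_add)
next
  case (Suc k)
  show ?case
    by (rule k_times_cont_diff_SucI[where f' = "\<lambda>x v. frechet_derivative f (at x) v + frechet_derivative g (at x) v"])
       (use Suc in \<open>auto intro!: has_derivative_add simp: frechet_derivative_works[symmetric]\<close>)
qed

lemma k_times_cont_diff_linear_compose:
  assumes "bounded_linear h"
  shows "k_times_cont_diff k f \<Longrightarrow> k_times_cont_diff k (\<lambda>x. h (f x))"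
proof (induction k arbitrary: f)
  case 0
  then show ?case using assms
    by (auto intro: bounded_linear.continuous_on)
next
  case (Suc k)
  show ?case
    by (rule k_times_cont_diff_SucI[where f' = "\<lambda>x v. h (frechet_derivative f (at x) v)"])
       (use Suc in \<open>auto intro!: bounded_linear.has_derivative[OF assms] simp: frechet_derivative_works[symmetric]\<close>)
qed

lemma k_times_cont_diff_mult:
  fixes f g :: "'a::euclidean_space \<Rightarrow> real"
  shows "k_times_cont_diff k f \<Longrightarrow> k_times_cont_diff k g \<Longrightarrow> k_times_cont_diff k (\<lambda>x. f x * g x)"
proof (induction k arbitrary: f g)
  case 0
  then show ?case by (auto intro: continuous_on_mult)
next
  case (Suc k)
  have fg: "k_times_cont_diff k f" "k_times_cont_diff k g"
    using Suc.prems by (blast intro: k_times_cont_diff_SucD)+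
  show ?case
    by (rule k_times_cont_diff_SucI[where f' = "\<lambda>x v. f x * frechet_derivative g (at x) v + frechet_derivative f (at x) v * g x"])
       (use Suc fg in \<open>auto intro!: has_derivative_mult k_times_cont_diff_add simp: frechet_derivative_works[symmetric]\<close>)
qed

lemma k_times_cont_diff_scale_arg:
  "k_times_cont_diff k f \<Longrightarrow> k_times_cont_diff k (\<lambda>x. f (c *\<^sub>R x))"
proof (induction k arbitrary: f)
  case 0
  then have "continuous_on UNIV f" by simp
  then show ?case
    by (auto intro!: continuous_on_compose2[of UNIV f] continuous_intros)
next
  case (Suc k)
  have D: "\<And>x. (f has_derivative frechet_derivative f (at x)) (at x)"
    using Suc.prems by (simp add: frechet_derivative_works[symmetric])
  show ?case
  proof (rule k_times_cont_diff_SucI[where f' = "\<lambda>x v. c *\<^sub>R frechet_derivative f (at (c *\<^sub>R x)) v"])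
    fix x :: 'a
    have "((\<lambda>x. c *\<^sub>R x) has_derivative (\<lambda>v. c *\<^sub>R v)) (at x)"
      by (auto intro!: derivative_eq_intros)
    from has_derivative_compose[OF this D[of "c *\<^sub>R x"]]
    show "((\<lambda>x. f (c *\<^sub>R x)) has_derivative (\<lambda>v. c *\<^sub>R frechet_derivative f (at (c *\<^sub>R x)) v)) (at x)"
      using linear_scale[OF has_derivative_linear[OF D[of "c *\<^sub>R x"]]] by simp
  next
    fix v
    show "k_times_cont_diff k (\<lambda>x. c *\<^sub>R frechet_derivative f (at (c *\<^sub>R x)) v)"
      using Suc by (intro k_times_cont_diff_linear_compose[where h="\<lambda>x. c *\<^sub>R x"] bounded_linear_scaleR_right Suc.IH) auto
  qed
qed

definition flat_fun :: "real poly \<Rightarrow> real \<Rightarrow> real" where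
  "flat_fun p x = (if x > 0 then poly p (inverse x) * exp (- inverse x) else 0)"

lemma poly_mult_exp_tendsto_0: "((\<lambda>t::real. poly p t * exp (- t)) \<longlongrightarrow> 0) at_top"
proof -
  have eq: "poly p t * exp (- t) = (\<Sum>i\<le>degree p. coeff p i * (t ^ i / exp t))" for t
    by (simp add: poly_altdef sum_distrib_right exp_minus divide_inverse mult.assoc)
  have "((\<lambda>t. \<Sum>i\<le>degree p. coeff p i * (t ^ i / exp t)) \<longlongrightarrow> (\<Sum>i\<le>degree p. coeff p i * 0)) at_top"
    by (intro tendsto_sum tendsto_mult tendsto_const tendsto_power_div_exp_0)
  then show ?thesis by (simp add: eq)
qed

lemma flat_fun_deriv:
  "(flat_fun p has_real_derivative flat_fun ([:0, 0, 1:] * (p - pderiv p)) x) (at x)"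
proof -
  consider "x > 0" | "x < 0" | "x = 0" by linarith
  then show ?thesis
  proof cases
    case 1
    have "((\<lambda>x. poly p (inverse x) * exp (- inverse x)) has_real_derivative
            flat_fun ([:0, 0, 1:] * (p - pderiv p)) x) (at x)"
      using 1 by (auto intro!: derivative_eq_intros poly_DERIV[THEN DERIV_chain2]
            simp: flat_fun_def field_simps power2_eq_square)
    then show ?thesis
      by (rule has_field_derivative_transform_within_open[where S="{0<..}"])
         (use 1 in \<open>auto simp: flat_fun_def\<close>)
  next
    case 2
    have "((\<lambda>x. 0) has_real_derivative 0) (at x)" by simp
    then have "(flat_fun p has_real_derivative 0) (at x)"
      by (rule has_field_derivative_transform_within_open[where S="{..<0}"])
         (use 2 in \<open>auto simp: flat_fun_def\<close>)
    then show ?thesis using 2 by (simp add: flat_fun_def)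
  next
    case 3
    have "((\<lambda>t. poly ([:0, 1:] * p) t * exp (- t)) \<longlongrightarrow> 0) at_top"
      by (rule poly_mult_exp_tendsto_0)
    from filterlim_compose[OF this filterlim_inverse_at_top_right]
    have "((\<lambda>y. poly ([:0, 1:] * p) (inverse y) * exp (- inverse y)) \<longlongrightarrow> 0) (at_right (0::real))" .
    then have R: "((\<lambda>y. flat_fun p y / y) \<longlongrightarrow> 0) (at_right 0)"
      by (rule Lim_transform_eventually)
         (auto simp: flat_fun_def field_simps eventually_at_right_less intro!: eventually_at_right_less[THEN eventually_mono])
    have L: "((\<lambda>y. flat_fun p y / y) \<longlongrightarrow> 0) (at_left 0)"
      by (rule Lim_transform_eventually[OF tendsto_const])
         (auto simp: flat_fun_def eventually_at_filter)
    have "((\<lambda>y. flat_fun p y / y) \<longlongrightarrow> 0) (at 0)"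
      using L R by (simp add: filterlim_at_split)
    then show ?thesis using 3
      by (simp add: has_field_derivative_iff flat_fun_def)
  qed
qed

lemma k_times_cont_diff_flat_fun:
  fixes u :: "'a::euclidean_space \<Rightarrow> real"
  assumes "\<And>j. k_times_cont_diff j u"
  shows "k_times_cont_diff k (\<lambda>x. flat_fun p (u x))"
proof (induction k arbitrary: p)
  case 0
  have "continuous_on UNIV u" using assms[of 0] by simp
  moreover have "continuous_on UNIV (flat_fun p)"
    by (rule DERIV_continuous_on) (rule flat_fun_deriv[THEN has_field_derivative_at_within])
  ultimately show ?case by (auto intro: continuous_on_compose2)
next
  case (Suc k)
  have u1: "(u has_derivative frechet_derivative u (at x)) (at x)" for x
    using assms[of 1] by (simp add: frechet_derivative_works[symmetric])
  show ?case
  proof (rule k_times_cont_diff_SucI[where f' = "\<lambda>x v. flat_fun ([:0, 0, 1:] * (p - pderiv p)) (u x) * frechet_derivative u (at x) v"])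
    fix x
    show "((\<lambda>x. flat_fun p (u x)) has_derivative (\<lambda>v. flat_fun ([:0, 0, 1:] * (p - pderiv p)) (u x) * frechet_derivative u (at x) v)) (at x)"
      using has_derivative_compose[OF u1 flat_fun_deriv[unfolded has_field_derivative_def]] .
  next
    fix v
    show "k_times_cont_diff k (\<lambda>x. flat_fun ([:0, 0, 1:] * (p - pderiv p)) (u x) * frechet_derivative u (at x) v)"
      using assms[of "Suc k"] by (intro k_times_cont_diff_mult Suc.IH) auto
  qed
qed

lemma smooth_linear_combination:
  fixes f g :: "'a::euclidean_space \<Rightarrow> complex"
  assumes "smooth f" "smooth g"
  shows "smooth (\<lambda>x. a *\<^sub>R f x + b *\<^sub>R g x)"
  using assms unfolding smooth_def
  by (auto intro!: k_times_cont_diff_add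
      k_times_cont_diff_linear_compose[where h="\<lambda>x. c *\<^sub>R x" for c] bounded_linear_scaleR_right)

lemma continuous_on_smooth: "smooth f \<Longrightarrow> continuous_on UNIV f"
  unfolding smooth_def by (metis k_times_cont_diff.simps(1))

lemma test_functionsI:
  assumes "smooth \<phi>" "compact K" "\<And>x. x \<notin> K \<Longrightarrow> \<phi> x = 0"
  shows "\<phi> \<in> test_functions"
proof -
  have "{x. \<phi> x \<noteq> 0} \<subseteq> K" using assms(3) by blast
  then have "compact (closure {x. \<phi> x \<noteq> 0})"
    using assms(2) by (meson bounded_subset compact_closure compact_imp_bounded)
  then show ?thesis using assms(1) by (simp add: test_functions_def)
qed

lemma test_functionsE:
  assumes "\<phi> \<in> test_functions"
  obtains K where "smooth \<phi>" "compact K" "\<And>x. x \<notin> K \<Longrightarrow> \<phi> x = 0"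
  using assms closure_subset[of "{x. \<phi> x \<noteq> 0}"] unfolding test_functions_def
  by blast

lemma test_functions_linear_combination:
  assumes "\<phi> \<in> test_functions" "\<psi> \<in> test_functions"
  shows "(\<lambda>x. a *\<^sub>R \<phi> x + b *\<^sub>R \<psi> x) \<in> test_functions"
proof -
  obtain K where K: "smooth \<phi>" "compact K" "\<And>x. x \<notin> K \<Longrightarrow> \<phi> x = 0"
    using assms(1) by (rule test_functionsE) blast
  obtain L where L: "smooth \<psi>" "compact L" "\<And>x. x \<notin> L \<Longrightarrow> \<psi> x = 0"
    using assms(2) by (rule test_functionsE) blast
  show ?thesis
    by (rule test_functionsI[of _ "K \<union> L"])
       (use K L in \<open>auto intro: smooth_linear_combination\<close>)
qed

lemma scale_fun_test_functions:
  fixes \<phi> :: "real ^ 'n::finite \<Rightarrow> complex"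
  assumes "\<phi> \<in> test_functions" "\<epsilon> > 0"
  shows "scale_fun \<epsilon> \<phi> \<in> test_functions"
proof -
  obtain K where K: "smooth \<phi>" "compact K" "\<And>x. x \<notin> K \<Longrightarrow> \<phi> x = 0"
    using assms(1) by (rule test_functionsE) blast
  show ?thesis
  proof (rule test_functionsI[of _ "(\<lambda>x. \<epsilon> *\<^sub>R x) ` K"])
    show "smooth (scale_fun \<epsilon> \<phi>)"
      unfolding smooth_def scale_fun_def
      using K(1) by (auto intro!: k_times_cont_diff_linear_compose[where h="\<lambda>x. c *\<^sub>R x" for c]
          bounded_linear_scaleR_right k_times_cont_diff_scale_arg simp: smooth_def)
    show "compact ((\<lambda>x. \<epsilon> *\<^sub>R x) ` K)"
      using K(2) by (rule compact_scaling)
  next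
    fix x assume "x \<notin> (\<lambda>x. \<epsilon> *\<^sub>R x) ` K"
    then have "x /\<^sub>R \<epsilon> \<notin> K"
      using assms(2) by (force simp: image_iff)
    then show "scale_fun \<epsilon> \<phi> x = 0" using K(3) by (simp add: scale_fun_def)
  qed
qed

lemma continuous_on_monomial: "continuous_on S (monomial \<alpha>)"
  unfolding monomial_def[abs_def] by (intro continuous_intros)

lemma integrable_monomial_test_function:
  assumes "\<phi> \<in> test_functions"
  shows "integrable lborel (\<lambda>x. monomial \<alpha> x *\<^sub>R \<phi> x)"
proof -
  obtain K where K: "smooth \<phi>" "compact K" "\<And>x. x \<notin> K \<Longrightarrow> \<phi> x = 0"
    using assms by (rule test_functionsE) blast
  have "integrable lborel (\<lambda>x. indicator K x *\<^sub>R (monomial \<alpha> x *\<^sub>R \<phi> x))"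
    by (intro borel_integrable_compact K(2) continuous_intros continuous_on_monomial)
       (use continuous_on_smooth[OF K(1)] continuous_on_subset in blast)
  also have "(\<lambda>x. indicator K x *\<^sub>R (monomial \<alpha> x *\<^sub>R \<phi> x)) = (\<lambda>x. monomial \<alpha> x *\<^sub>R \<phi> x)"
    using K(3) by (auto simp: indicator_def fun_eq_iff)
  finally show ?thesis .
qed

lemma moment_scale_fun:
  fixes \<phi> :: "real ^ 'n::finite \<Rightarrow> complex"
  assumes "\<phi> \<in> test_functions" "\<epsilon> > 0"
  shows "(LINT x|lborel. monomial \<alpha> x *\<^sub>R scale_fun \<epsilon> \<phi> x) =
    \<epsilon> ^ (\<Sum>i\<in>UNIV. \<alpha> i) *\<^sub>R (LINT x|lborel. monomial \<alpha> x *\<^sub>R \<phi> x)"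
proof -
  have cont: "continuous_on UNIV (\<lambda>x. monomial \<alpha> x *\<^sub>R scale_fun \<epsilon> \<phi> x)"
    using scale_fun_test_functions[OF assms]
    by (auto intro!: continuous_intros continuous_on_monomial elim!: test_functionsE
        intro: continuous_on_smooth)
  then have [measurable]: "(\<lambda>x. monomial \<alpha> x *\<^sub>R scale_fun \<epsilon> \<phi> x) \<in> borel_measurable borel"
    by (rule borel_measurable_continuous_onI)
  have mono: "monomial \<alpha> (\<epsilon> *\<^sub>R x) = \<epsilon> ^ (\<Sum>i\<in>UNIV. \<alpha> i) * monomial \<alpha> x" for x
    by (simp add: monomial_def power_mult_distrib prod.distrib power_sum)
  have "(LINT x|lborel. monomial \<alpha> x *\<^sub>R scale_fun \<epsilon> \<phi> x) =
    (LINT x|density (distr lborel borel (\<lambda>x::real^'n. 0 + \<epsilon> *\<^sub>R x)) (\<lambda>_. ennreal (\<bar>\<epsilon>\<bar> ^ DIM(real^'n))).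
       monomial \<alpha> x *\<^sub>R scale_fun \<epsilon> \<phi> x)"
    using lborel_affine[of \<epsilon> "0::real^'n"] assms(2) by (simp add: ennreal_power)
  also have "\<dots> = (LINT x|lborel. \<epsilon> ^ CARD('n) *\<^sub>R (monomial \<alpha> (\<epsilon> *\<^sub>R x) *\<^sub>R scale_fun \<epsilon> \<phi> (\<epsilon> *\<^sub>R x)))"
    using assms(2)
    by (subst integral_density, simp, simp, simp, subst integral_distr)
       (auto simp del: scaleR_scaleR)
  also have "\<dots> = (LINT x|lborel. \<epsilon> ^ (\<Sum>i\<in>UNIV. \<alpha> i) *\<^sub>R (monomial \<alpha> x *\<^sub>R \<phi> x))"
    using assms(2) by (intro Bochner_Integration.integral_cong) (auto simp: scale_fun_def mono)
  also have "\<dots> = \<epsilon> ^ (\<Sum>i\<in>UNIV. \<alpha> i) *\<^sub>R (LINT x|lborel. monomial \<alpha> x *\<^sub>R \<phi> x)"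
    by (rule integral_scaleR_right)
  finally show ?thesis .
qed

lemma monomial_0 [simp]: "monomial (\<lambda>_. 0) x = 1"
  by (simp add: monomial_def)

lemma integral_scale_fun:
  assumes "\<phi> \<in> test_functions" "\<epsilon> > 0"
  shows "(LINT x|lborel. scale_fun \<epsilon> \<phi> x) = (LINT x|lborel. \<phi> x)"
  using moment_scale_fun[OF assms, of "\<lambda>_. 0"] by simp

lemma scale_fun_test_objects:
  "\<phi> \<in> test_objects q \<Longrightarrow> \<epsilon> > 0 \<Longrightarrow> scale_fun \<epsilon> \<phi> \<in> test_objects q"
  by (auto simp: test_objects_def scale_fun_test_functions integral_scale_fun moment_scale_fun)

lemma test_objects_antimono: "p \<le> q \<Longrightarrow> test_objects q \<subseteq> test_objects p"
  by (auto simp: test_objects_def)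

lemma test_objects_0_nonempty: "\<exists>\<phi>. (\<phi> :: real ^ 'n::finite \<Rightarrow> complex) \<in> test_objects 0"
proof -
  define b where "b = (\<lambda>x::real^'n. flat_fun 1 (1 - x \<bullet> x))"
  have ball: "b x = 0" if "x \<notin> cball 0 1" for x
  proof -
    have "1 < norm x" using that by simp
    then have "1 < (norm x)\<^sup>2" by (simp add: one_less_power)
    then show ?thesis by (simp add: b_def flat_fun_def power2_norm_eq_inner)
  qed
  have pos: "b x \<ge> 0" for x by (simp add: b_def flat_fun_def)
  have sm_u: "k_times_cont_diff k (\<lambda>x::real^'n. 1 - x \<bullet> x)" for k
  proof (cases k)
    case 0
    then show ?thesis by (auto intro!: continuous_intros)
  next
    case (Suc j)
    show ?thesis unfolding Suc
    proof (rule k_times_cont_diff_SucI[where f' = "\<lambda>x v. - 2 * (x \<bullet> v)"])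
      fix x :: "real^'n"
      show "((\<lambda>x. 1 - x \<bullet> x) has_derivative (\<lambda>v. - 2 * (x \<bullet> v))) (at x)"
        by (auto intro!: derivative_eq_intros simp: inner_commute)
    next
      fix v :: "real^'n"
      show "k_times_cont_diff j (\<lambda>x. - 2 * (x \<bullet> v))"
        by (rule k_times_cont_diff_linear) (intro bounded_linear_const_mult bounded_linear_inner_left)
    qed
  qed
  have sm: "smooth (\<lambda>x. c *\<^sub>R complex_of_real (b x))" for c
    unfolding smooth_def b_def
    by (intro allI k_times_cont_diff_linear_compose[where h="\<lambda>x. c *\<^sub>R complex_of_real x"]
        k_times_cont_diff_flat_fun sm_u bounded_linear_compose[OF bounded_linear_scaleR_right] bounded_linear_of_real)
  have tf: "(\<lambda>x. c *\<^sub>R complex_of_real (b x)) \<in> test_functions" for c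
    by (rule test_functionsI[OF sm, of "cball 0 1"]) (use ball in auto)
  have int: "integrable lborel (\<lambda>x. complex_of_real (b x))"
    using integrable_monomial_test_function[OF tf[of 1], of "\<lambda>_. 0"] by simp
  then have intb: "integrable lborel b" by (simp add: complex_of_real_integrable_eq)
  have contb: "continuous_on UNIV b"
    unfolding b_def using k_times_cont_diff_flat_fun[OF sm_u, of 0] by simp
  have "integral\<^sup>L lborel b \<noteq> 0"
  proof
    assume "integral\<^sup>L lborel b = 0"
    then have "AE x in lborel. b x = 0"
      using integral_nonneg_eq_0_iff_AE[OF intb] pos by simp
    moreover have op: "open {x. b x \<noteq> 0}"
      using contb by (simp add: open_Collect_neq)
    ultimately have "{x. b x \<noteq> 0} \<in> null_sets lborel"
      by (subst (asm) AE_iff_null) auto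
    then have "negligible {x. b x \<noteq> 0}"
      by (simp add: negligible_iff_null_sets null_sets_completionI)
    then have "{x. b x \<noteq> 0} = {}"
      using open_not_negligible[OF op] by blast
    moreover have "b 0 \<noteq> 0" by (simp add: b_def flat_fun_def)
    ultimately show False by blast
  qed
  then have "(LINT x|lborel. inverse (integral\<^sup>L lborel b) *\<^sub>R complex_of_real (b x)) = 1"
    using int by (simp add: scaleR_conv_of_real)
  then have "(\<lambda>x. inverse (integral\<^sup>L lborel b) *\<^sub>R complex_of_real (b x)) \<in> test_objects 0"
    unfolding test_objects_def using tf by (intro CollectI conjI allI impI) auto
  then show ?thesis by blast
qed

lemma test_objects_nonempty: "\<exists>\<phi>. (\<phi> :: real ^ 'n::finite \<Rightarrow> complex) \<in> test_objects q"
proof (induction q)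
  case 0
  then show ?case by (rule test_objects_0_nonempty)
next
  case (Suc q)
  then obtain \<phi> :: "real ^ 'n \<Rightarrow> complex" where \<phi>: "\<phi> \<in> test_objects q" by blast
  define d :: real where "d = 2 ^ Suc q - 1"
  have "(2::real) ^ Suc q > 1" by (rule one_less_power) auto
  then have d: "d > 0" by (simp add: d_def)
  define a b where "a = 1 + 1 / d" and "b = - 1 / d"
  have ab: "a + b = 1" by (simp add: a_def b_def)
  have ab2: "a + b * 2 ^ Suc q = 0"
    proof -
    have "2 ^ Suc q = d + 1" by (simp add: d_def)
    then have "a + b * 2 ^ Suc q = 1 - (1 / d) * d"
      unfolding a_def b_def by (simp only: distrib_left)
    then show ?thesis using d by simp
  qed
  define \<psi> where "\<psi> = (\<lambda>x. a *\<^sub>R \<phi> x + b *\<^sub>R scale_fun 2 \<phi> x)"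
  have t: "\<phi> \<in> test_functions" "(LINT x|lborel. \<phi> x) = 1" using \<phi> by (auto simp: test_objects_def)
  have t2: "scale_fun 2 \<phi> \<in> test_functions" using t by (simp add: scale_fun_test_functions)
  have mom: "(LINT x|lborel. monomial \<alpha> x *\<^sub>R \<psi> x) =
      (a + b * 2 ^ (\<Sum>i\<in>UNIV. \<alpha> i)) *\<^sub>R (LINT x|lborel. monomial \<alpha> x *\<^sub>R \<phi> x)" for \<alpha>
  proof -
    have "(LINT x|lborel. monomial \<alpha> x *\<^sub>R \<psi> x) =
      (LINT x|lborel. a *\<^sub>R (monomial \<alpha> x *\<^sub>R \<phi> x) + b *\<^sub>R (monomial \<alpha> x *\<^sub>R scale_fun 2 \<phi> x))"
      unfolding \<psi>_def by (simp add: scaleR_right_distrib mult.commute)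
    also have "\<dots> = a *\<^sub>R (LINT x|lborel. monomial \<alpha> x *\<^sub>R \<phi> x) + b *\<^sub>R (LINT x|lborel. monomial \<alpha> x *\<^sub>R scale_fun 2 \<phi> x)"
      using integrable_monomial_test_function[OF t(1), of \<alpha>] integrable_monomial_test_function[OF t2, of \<alpha>]
      by (subst Bochner_Integration.integral_add) (auto simp del: scaleR_scaleR)
    finally show ?thesis
      by (simp add: moment_scale_fun[OF t(1)] scaleR_left_distrib)
  qed
  have "\<psi> \<in> test_objects (Suc q)"
    unfolding test_objects_def
  proof (intro CollectI conjI allI impI)
    show "\<psi> \<in> test_functions"
      unfolding \<psi>_def by (rule test_functions_linear_combination[OF t(1) t2])
    show "(LINT x|lborel. \<psi> x) = 1"
      using mom[of "\<lambda>_. 0"] t ab by simp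
  next
    fix \<alpha> :: "'n \<Rightarrow> nat"
    assume \<alpha>: "1 \<le> (\<Sum>i\<in>UNIV. \<alpha> i) \<and> (\<Sum>i\<in>UNIV. \<alpha> i) \<le> Suc q"
    show "(LINT x|lborel. monomial \<alpha> x *\<^sub>R \<psi> x) = 0"
    proof (cases "(\<Sum>i\<in>UNIV. \<alpha> i) = Suc q")
      case True
      then show ?thesis using mom[of \<alpha>] ab2 by simp
    next
      case False
      then have "(LINT x|lborel. monomial \<alpha> x *\<^sub>R \<phi> x) = 0"
        using \<phi> \<alpha> unfolding test_objects_def by auto
      then show ?thesis using mom[of \<alpha>] by simp
    qed
  qed
  then show ?case by blast
qed


section \<open>The ring of generalized numbers\<close>

lemma bigo_inverse_power_mono:
  assumes "N \<le> M" "f \<in> O[at_right 0](\<lambda>\<epsilon>::real. inverse (\<epsilon> ^ N))"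
  shows "f \<in> O[at_right 0](\<lambda>\<epsilon>::real. inverse (\<epsilon> ^ M))"
proof -
  have "(\<lambda>\<epsilon>::real. inverse (\<epsilon> ^ N)) \<in> O[at_right 0](\<lambda>\<epsilon>. inverse (\<epsilon> ^ M))"
  proof (rule bigoI[where c=1])
    have "eventually (\<lambda>\<epsilon>. \<epsilon> \<in> {0<..<1}) (at_right (0::real))"
      by (rule eventually_at_right_real) simp
    then show "\<forall>\<^sub>F \<epsilon> in at_right (0::real). norm (inverse (\<epsilon> ^ N)) \<le> 1 * norm (inverse (\<epsilon> ^ M))"
      by eventually_elim (auto intro!: le_imp_inverse_le power_decreasing assms(1))
  qed
  with assms(2) show ?thesis by (rule landau_o.big_trans)
qed

lemma bigo_norm_add:
  fixes f g :: "real \<Rightarrow> complex"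
  assumes "(\<lambda>\<epsilon>. norm (f \<epsilon>)) \<in> O[F](h)" "(\<lambda>\<epsilon>. norm (g \<epsilon>)) \<in> O[F](h)"
  shows "(\<lambda>\<epsilon>. norm (f \<epsilon> + g \<epsilon>)) \<in> O[F](h)"
proof -
  have "(\<lambda>\<epsilon>. norm (f \<epsilon> + g \<epsilon>)) \<in> O[F](\<lambda>\<epsilon>. norm (f \<epsilon>) + norm (g \<epsilon>))"
    by (rule bigoI[where c=1]) (auto intro: norm_triangle_ineq always_eventually)
  with sum_in_bigo(1)[OF assms] show ?thesis by (metis landau_o.big_trans)
qed

lemma moderateI:
  assumes "\<And>\<phi>. \<phi> \<in> test_objects N \<Longrightarrow>
    (\<lambda>\<epsilon>. norm (r (scale_fun \<epsilon> \<phi>))) \<in> O[at_right 0](\<lambda>\<epsilon>. inverse (\<epsilon> ^ N))"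
  shows "r \<in> moderate"
  unfolding moderate_def
proof (intro CollectI exI[of _ "Suc N"] conjI ballI)
  fix \<phi> :: "real ^ 'a \<Rightarrow> complex" assume "\<phi> \<in> test_objects (Suc N)"
  then have "\<phi> \<in> test_objects N" using test_objects_antimono[of N "Suc N"] by auto
  from assms[OF this]
  show "(\<lambda>\<epsilon>. norm (r (scale_fun \<epsilon> \<phi>))) \<in> O[at_right 0](\<lambda>\<epsilon>. inverse (\<epsilon> ^ Suc N))"
    by (rule bigo_inverse_power_mono[rotated]) simp
qed simp

lemma moderateE:
  assumes "r \<in> moderate"
  obtains N where "\<And>M \<phi>. N \<le> M \<Longrightarrow> \<phi> \<in> test_objects M \<Longrightarrow>
    (\<lambda>\<epsilon>. norm (r (scale_fun \<epsilon> \<phi>))) \<in> O[at_right 0](\<lambda>\<epsilon>. inverse (\<epsilon> ^ N))"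
proof -
  obtain N where N: "\<And>\<phi>. \<phi> \<in> test_objects N \<Longrightarrow>
    (\<lambda>\<epsilon>. norm (r (scale_fun \<epsilon> \<phi>))) \<in> O[at_right 0](\<lambda>\<epsilon>. inverse (\<epsilon> ^ N))"
    using assms unfolding moderate_def by blast
  show ?thesis
    using that[of N] N test_objects_antimono by blast
qed

lemma moderate_const: "(\<lambda>_. c) \<in> moderate"
  by (rule moderateI[of 0]) simp

lemma moderate_add:
  assumes "r \<in> moderate" "s \<in> moderate"
  shows "(\<lambda>\<phi>. r \<phi> + s \<phi>) \<in> moderate"
proof -
  obtain N where N: "\<And>M \<phi>. N \<le> M \<Longrightarrow> \<phi> \<in> test_objects M \<Longrightarrow>
    (\<lambda>\<epsilon>. norm (r (scale_fun \<epsilon> \<phi>))) \<in> O[at_right 0](\<lambda>\<epsilon>. inverse (\<epsilon> ^ N))"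
    using assms(1) by (rule moderateE) blast
  obtain L where L: "\<And>M \<phi>. L \<le> M \<Longrightarrow> \<phi> \<in> test_objects M \<Longrightarrow>
    (\<lambda>\<epsilon>. norm (s (scale_fun \<epsilon> \<phi>))) \<in> O[at_right 0](\<lambda>\<epsilon>. inverse (\<epsilon> ^ L))"
    using assms(2) by (rule moderateE) blast
  show ?thesis
    by (rule moderateI[of "max N L"], rule bigo_norm_add)
       (rule bigo_inverse_power_mono[OF _ N[of "max N L"]] bigo_inverse_power_mono[OF _ L[of "max N L"]]; simp)+
qed

lemma moderate_mult:
  assumes "r \<in> moderate" "s \<in> moderate"
  shows "(\<lambda>\<phi>. r \<phi> * s \<phi>) \<in> moderate"
proof -
  obtain N where N: "\<And>M \<phi>. N \<le> M \<Longrightarrow> \<phi> \<in> test_objects M \<Longrightarrow>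
    (\<lambda>\<epsilon>. norm (r (scale_fun \<epsilon> \<phi>))) \<in> O[at_right 0](\<lambda>\<epsilon>. inverse (\<epsilon> ^ N))"
    using assms(1) by (rule moderateE) blast
  obtain L where L: "\<And>M \<phi>. L \<le> M \<Longrightarrow> \<phi> \<in> test_objects M \<Longrightarrow>
    (\<lambda>\<epsilon>. norm (s (scale_fun \<epsilon> \<phi>))) \<in> O[at_right 0](\<lambda>\<epsilon>. inverse (\<epsilon> ^ L))"
    using assms(2) by (rule moderateE) blast
  show ?thesis
  proof (rule moderateI[of "N + L"])
    fix \<phi> :: "real ^ 'a \<Rightarrow> complex" assume "\<phi> \<in> test_objects (N + L)"
    then show "(\<lambda>\<epsilon>. norm (r (scale_fun \<epsilon> \<phi>) * s (scale_fun \<epsilon> \<phi>))) \<in> O[at_right 0](\<lambda>\<epsilon>. inverse (\<epsilon> ^ (N + L)))"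
      using landau_o.big.mult[OF N[of "N + L" \<phi>] L[of "N + L" \<phi>]]
      by (simp add: norm_mult power_add)
  qed
qed

lemma moderate_uminus: "r \<in> moderate \<Longrightarrow> (\<lambda>\<phi>. - r \<phi>) \<in> moderate"
  by (simp add: moderate_def)

lemma moderate_diff: "r \<in> moderate \<Longrightarrow> s \<in> moderate \<Longrightarrow> (\<lambda>\<phi>. r \<phi> - s \<phi>) \<in> moderate"
  using moderate_add[OF _ moderate_uminus] by fastforce

lemmas moderate_intros =
  moderate_const moderate_add moderate_mult moderate_uminus moderate_diff

lemma null_functions_0: "(\<lambda>_. 0) \<in> null_functions"
  by (auto simp: null_functions_def)

lemma null_functions_uminus: "r \<in> null_functions \<Longrightarrow> (\<lambda>\<phi>. - r \<phi>) \<in> null_functions"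
  by (simp add: null_functions_def)

lemma null_functions_add:
  assumes "r \<in> null_functions" "s \<in> null_functions"
  shows "(\<lambda>\<phi>. r \<phi> + s \<phi>) \<in> null_functions"
  unfolding null_functions_def
proof (intro CollectI allI impI)
  fix m :: nat assume m: "1 \<le> m"
  obtain p where p: "p \<ge> 1" "\<And>\<phi>. \<phi> \<in> test_objects p \<Longrightarrow>
      (\<lambda>\<epsilon>. norm (r (scale_fun \<epsilon> \<phi>))) \<in> O[at_right 0](\<lambda>\<epsilon>. \<epsilon> ^ m)"
    using assms(1) m unfolding null_functions_def by blast
  obtain q where q: "q \<ge> 1" "\<And>\<phi>. \<phi> \<in> test_objects q \<Longrightarrow>
      (\<lambda>\<epsilon>. norm (s (scale_fun \<epsilon> \<phi>))) \<in> O[at_right 0](\<lambda>\<epsilon>. \<epsilon> ^ m)"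
    using assms(2) m unfolding null_functions_def by blast
  have sub: "\<phi> \<in> test_objects p \<and> \<phi> \<in> test_objects q" if "\<phi> \<in> test_objects (max p q)"
    for \<phi> :: "real ^ 'a \<Rightarrow> complex"
    using that test_objects_antimono[of p "max p q"] test_objects_antimono[of q "max p q"] by auto
  show "\<exists>q\<ge>1. \<forall>\<phi>\<in>test_objects q.
      (\<lambda>\<epsilon>. norm (r (scale_fun \<epsilon> \<phi>) + s (scale_fun \<epsilon> \<phi>))) \<in> O[at_right 0](\<lambda>\<epsilon>. \<epsilon> ^ m)"
    by (rule exI[of _ "max p q"]) (use p q sub in \<open>auto intro!: bigo_norm_add\<close>)
qed

lemma null_functions_mult:
  assumes "r \<in> null_functions" "s \<in> moderate"
  shows "(\<lambda>\<phi>. r \<phi> * s \<phi>) \<in> null_functions"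
  unfolding null_functions_def
proof (intro CollectI allI impI)
  fix m :: nat assume m: "1 \<le> m"
  obtain L where L: "\<And>M \<phi>. L \<le> M \<Longrightarrow> \<phi> \<in> test_objects M \<Longrightarrow>
    (\<lambda>\<epsilon>. norm (s (scale_fun \<epsilon> \<phi>))) \<in> O[at_right 0](\<lambda>\<epsilon>. inverse (\<epsilon> ^ L))"
    using assms(2) by (rule moderateE) blast
  have "1 \<le> m + L" using m by simp
  then obtain p where p: "p \<ge> 1" "\<And>\<phi>. \<phi> \<in> test_objects p \<Longrightarrow>
      (\<lambda>\<epsilon>. norm (r (scale_fun \<epsilon> \<phi>))) \<in> O[at_right 0](\<lambda>\<epsilon>. \<epsilon> ^ (m + L))"
    using assms(1) unfolding null_functions_def by blast
  have "(\<lambda>\<epsilon>. norm (r (scale_fun \<epsilon> \<phi>) * s (scale_fun \<epsilon> \<phi>))) \<in> O[at_right 0](\<lambda>\<epsilon>. \<epsilon> ^ m)"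
    if \<phi>: "\<phi> \<in> test_objects (p + L)" for \<phi> :: "real ^ 'a \<Rightarrow> complex"
  proof -
    have "\<phi> \<in> test_objects p" using \<phi> test_objects_antimono[of p "p + L"] by auto
    then have "(\<lambda>\<epsilon>. norm (r (scale_fun \<epsilon> \<phi>) * s (scale_fun \<epsilon> \<phi>))) \<in>
        O[at_right 0](\<lambda>\<epsilon>. \<epsilon> ^ (m + L) * inverse (\<epsilon> ^ L))"
      using landau_o.big.mult[OF p(2) L[OF _ \<phi>]] by (simp add: norm_mult)
    moreover have "(\<lambda>\<epsilon>::real. \<epsilon> ^ (m + L) * inverse (\<epsilon> ^ L)) \<in> O[at_right 0](\<lambda>\<epsilon>. \<epsilon> ^ m)"
    proof (rule bigoI[where c=1])
      have "\<forall>\<^sub>F \<epsilon> in at_right (0::real). \<epsilon> > 0" by (rule eventually_at_right_less)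
      then show "\<forall>\<^sub>F \<epsilon> in at_right (0::real). norm (\<epsilon> ^ (m + L) * inverse (\<epsilon> ^ L)) \<le> 1 * norm (\<epsilon> ^ m)"
        by eventually_elim (simp add: power_add)
    qed
    ultimately show ?thesis by (rule landau_o.big_trans)
  qed
  then show "\<exists>q\<ge>1. \<forall>\<phi>\<in>test_objects q.
      (\<lambda>\<epsilon>. norm (r (scale_fun \<epsilon> \<phi>) * s (scale_fun \<epsilon> \<phi>))) \<in> O[at_right 0](\<lambda>\<epsilon>. \<epsilon> ^ m)"
    using p(1) by (intro exI[of _ "p + L"]) auto
qed

lemma one_not_null_functions: "(\<lambda>_. 1) \<notin> (null_functions :: ((real ^ 'n::finite \<Rightarrow> complex) \<Rightarrow> complex) set)"
proof
  assume "(\<lambda>_. 1) \<in> (null_functions :: ((real ^ 'n \<Rightarrow> complex) \<Rightarrow> complex) set)"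
  then obtain q where q: "\<And>\<phi>::real^'n\<Rightarrow>complex. \<phi> \<in> test_objects q \<Longrightarrow>
      (\<lambda>\<epsilon>::real. 1::real) \<in> O[at_right 0](\<lambda>\<epsilon>. \<epsilon> ^ 1)"
    unfolding null_functions_def by force
  obtain \<phi> :: "real ^ 'n \<Rightarrow> complex" where "\<phi> \<in> test_objects q"
    using test_objects_nonempty by blast
  from q[OF this] obtain c where c: "c > 0" and ev: "\<forall>\<^sub>F \<epsilon> in at_right (0::real). 1 \<le> c * \<epsilon>"
  proof (rule landau_o.bigE)
    fix c :: real assume "c > 0" and le: "\<forall>\<^sub>F \<epsilon> in at_right (0::real). norm (1::real) \<le> c * norm (\<epsilon> ^ 1)"
    have "\<forall>\<^sub>F \<epsilon> in at_right (0::real). \<epsilon> > 0" by (rule eventually_at_right_less)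
    with le have "\<forall>\<^sub>F \<epsilon> in at_right (0::real). 1 \<le> c * \<epsilon>"
      by eventually_elim auto
    then show ?thesis using that \<open>c > 0\<close> by blast
  qed
  have "\<forall>\<^sub>F \<epsilon> in at_right (0::real). \<epsilon> \<in> {0<..<1 / c}"
    using c by (intro eventually_at_right_real) auto
  with ev have "\<forall>\<^sub>F \<epsilon> in at_right (0::real). False"
    by eventually_elim (use c in \<open>auto simp: field_simps\<close>)
  then show False by simp
qed

lemma colombeau_rel_cong:
  assumes r: "r \<in> moderate" and rs: "\<And>\<phi>. \<phi> \<in> test_objects 0 \<Longrightarrow> r \<phi> = s \<phi>"
  shows "colombeau_rel r s"
proof -
  have ev: "\<forall>\<^sub>F \<epsilon> in at_right 0. r (scale_fun \<epsilon> \<phi>) = s (scale_fun \<epsilon> \<phi>)"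
    if "\<phi> \<in> test_objects q" for \<phi> q
    using eventually_at_right_less
  proof eventually_elim
    fix \<epsilon> :: real assume "0 < \<epsilon>"
    then show "r (scale_fun \<epsilon> \<phi>) = s (scale_fun \<epsilon> \<phi>)"
      using rs scale_fun_test_objects[OF that] test_objects_antimono[of 0 q] by blast
  qed
  have "s \<in> moderate"
  proof -
    obtain N where N: "\<And>\<phi>. \<phi> \<in> test_objects N \<Longrightarrow>
      (\<lambda>\<epsilon>. norm (r (scale_fun \<epsilon> \<phi>))) \<in> O[at_right 0](\<lambda>\<epsilon>. inverse (\<epsilon> ^ N))"
      using r unfolding moderate_def by blast
    show ?thesis
    proof (rule moderateI[of N])
      fix \<phi> :: "real ^ 'a \<Rightarrow> complex" assume \<phi>: "\<phi> \<in> test_objects N"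
      have "\<forall>\<^sub>F \<epsilon> in at_right 0. norm (r (scale_fun \<epsilon> \<phi>)) = norm (s (scale_fun \<epsilon> \<phi>))"
        using ev[OF \<phi>] by eventually_elim simp
      from landau_o.big.in_cong[OF this] N[OF \<phi>]
      show "(\<lambda>\<epsilon>. norm (s (scale_fun \<epsilon> \<phi>))) \<in> O[at_right 0](\<lambda>\<epsilon>. inverse (\<epsilon> ^ N))" by blast
    qed
  qed
  moreover have "(\<lambda>\<phi>. r \<phi> - s \<phi>) \<in> null_functions"
    unfolding null_functions_def
  proof (intro CollectI allI impI exI[of _ 1] conjI ballI)
    fix m :: nat and \<phi> :: "real ^ 'a \<Rightarrow> complex" assume \<phi>: "\<phi> \<in> test_objects 1"
    have "\<forall>\<^sub>F \<epsilon> in at_right 0. norm (r (scale_fun \<epsilon> \<phi>) - s (scale_fun \<epsilon> \<phi>)) = 0"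
      using ev[OF \<phi>] by eventually_elim simp
    from landau_o.big.in_cong[OF this]
    show "(\<lambda>\<epsilon>. norm (r (scale_fun \<epsilon> \<phi>) - s (scale_fun \<epsilon> \<phi>))) \<in> O[at_right 0](\<lambda>\<epsilon>. \<epsilon> ^ m)"
      by simp
  qed simp
  ultimately show ?thesis using r by (simp add: colombeau_rel_def)
qed

lemma part_equivp_colombeau_rel: "part_equivp colombeau_rel"
proof (rule part_equivpI)
  show "\<exists>r. colombeau_rel r r"
    by (rule exI[of _ "\<lambda>_. 0"]) (simp add: colombeau_rel_def moderate_const null_functions_0)
  show "symp colombeau_rel"
    using null_functions_uminus by (fastforce simp: symp_def colombeau_rel_def)
  show "transp colombeau_rel"
    using null_functions_add by (fastforce simp: transp_def colombeau_rel_def)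
qed

lemma colombeau_relI:
  assumes "r \<in> moderate" "\<And>\<phi>. r \<phi> = s \<phi>"
  shows "colombeau_rel r s"
  using colombeau_rel_cong[OF assms(1)] assms(2) by blast

lemma colombeau_relD1: "colombeau_rel r s \<Longrightarrow> r \<in> moderate"
  by (simp add: colombeau_rel_def)

quotient_type (overloaded) 'n colombeau_number =
  "(real ^ 'n::finite \<Rightarrow> complex) \<Rightarrow> complex" / partial: colombeau_rel
  by (rule part_equivp_colombeau_rel)

instantiation colombeau_number :: (finite) comm_ring_1
begin

lift_definition zero_colombeau_number :: "'a colombeau_number" is "\<lambda>_. 0"
  by (simp add: colombeau_rel_def moderate_const null_functions_0)

lift_definition one_colombeau_number :: "'a colombeau_number" is "\<lambda>_. 1"
  by (simp add: colombeau_rel_def moderate_const null_functions_0)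

lift_definition plus_colombeau_number ::
    "'a colombeau_number \<Rightarrow> 'a colombeau_number \<Rightarrow> 'a colombeau_number"
  is "\<lambda>r s \<phi>. r \<phi> + s \<phi>"
  unfolding colombeau_rel_def
  using null_functions_add by (fastforce intro: moderate_add simp: algebra_simps)

lift_definition uminus_colombeau_number :: "'a colombeau_number \<Rightarrow> 'a colombeau_number"
  is "\<lambda>r \<phi>. - r \<phi>"
  unfolding colombeau_rel_def
  using null_functions_uminus by (fastforce intro: moderate_uminus)

lift_definition minus_colombeau_number ::
    "'a colombeau_number \<Rightarrow> 'a colombeau_number \<Rightarrow> 'a colombeau_number"
  is "\<lambda>r s \<phi>. r \<phi> - s \<phi>"
proof -
  fix r r' s s' :: "(real ^ 'a \<Rightarrow> complex) \<Rightarrow> complex"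
  assume a: "colombeau_rel r r'" "colombeau_rel s s'"
  have "(\<lambda>\<phi>. (r \<phi> - r' \<phi>) + - (s \<phi> - s' \<phi>)) \<in> null_functions"
    using a by (intro null_functions_add null_functions_uminus) (auto simp: colombeau_rel_def)
  moreover have "(\<lambda>\<phi>. r \<phi> + - s \<phi>) \<in> moderate" "(\<lambda>\<phi>. r' \<phi> + - s' \<phi>) \<in> moderate"
    using a by (auto intro!: moderate_add moderate_uminus simp only: colombeau_rel_def)
  ultimately show "colombeau_rel (\<lambda>\<phi>. r \<phi> - s \<phi>) (\<lambda>\<phi>. r' \<phi> - s' \<phi>)"
    by (simp add: colombeau_rel_def algebra_simps)
qed

lift_definition times_colombeau_number ::
    "'a colombeau_number \<Rightarrow> 'a colombeau_number \<Rightarrow> 'a colombeau_number"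
  is "\<lambda>r s \<phi>. r \<phi> * s \<phi>"
proof -
  fix r r' s s' :: "(real ^ 'a \<Rightarrow> complex) \<Rightarrow> complex"
  assume a: "colombeau_rel r r'" "colombeau_rel s s'"
  have "(\<lambda>\<phi>. (r \<phi> - r' \<phi>) * s \<phi> + (s \<phi> - s' \<phi>) * r' \<phi>) \<in> null_functions"
    using a by (intro null_functions_add null_functions_mult) (auto simp: colombeau_rel_def)
  then show "colombeau_rel (\<lambda>\<phi>. r \<phi> * s \<phi>) (\<lambda>\<phi>. r' \<phi> * s' \<phi>)"
    using a by (simp add: colombeau_rel_def algebra_simps moderate_mult)
qed

instance
proof
  fix a b c :: "'a colombeau_number"
  show "a * b * c = a * (b * c)"
    by (transfer, rule colombeau_relI)
       ((intro moderate_intros colombeau_relD1; assumption) | simp add: algebra_simps)+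
  show "a * b = b * a"
    by (transfer, rule colombeau_relI)
       ((intro moderate_intros colombeau_relD1; assumption) | simp add: algebra_simps)+
  show "1 * a = a"
    by (transfer, rule colombeau_relI)
       ((intro moderate_intros colombeau_relD1; assumption) | simp add: algebra_simps)+
  show "a + b + c = a + (b + c)"
    by (transfer, rule colombeau_relI)
       ((intro moderate_intros colombeau_relD1; assumption) | simp add: algebra_simps)+
  show "a + b = b + a"
    by (transfer, rule colombeau_relI)
       ((intro moderate_intros colombeau_relD1; assumption) | simp add: algebra_simps)+
  show "0 + a = a"
    by (transfer, rule colombeau_relI)
       ((intro moderate_intros colombeau_relD1; assumption) | simp add: algebra_simps)+
  show "- a + a = 0"
    by (transfer, rule colombeau_relI)
       ((intro moderate_intros colombeau_relD1; assumption) | simp add: algebra_simps)+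
  show "a - b = a + - b"
    by (transfer, rule colombeau_relI)
       ((intro moderate_intros colombeau_relD1; assumption) | simp add: algebra_simps)+
  show "(a + b) * c = a * c + b * c"
    by (transfer, rule colombeau_relI)
       ((intro moderate_intros colombeau_relD1; assumption) | simp add: algebra_simps)+
  show "(0::'a colombeau_number) \<noteq> 1"
  proof (transfer, rule notI)
    assume "colombeau_rel (\<lambda>_. 0) (\<lambda>_::real ^ 'a \<Rightarrow> complex. 1)"
    then have "(\<lambda>_::real ^ 'a \<Rightarrow> complex. 0 - 1) \<in> null_functions"
      unfolding colombeau_rel_def by blast
    from null_functions_uminus[OF this] show False
      using one_not_null_functions[where 'n='a] by simp
  qed
qed

end


section \<open>Non-degenerate matrices\<close>

definition non_degenerate :: "'a::comm_ring_1 ^ 'm ^ 'm \<Rightarrow> bool" where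
  "non_degenerate A \<longleftrightarrow> (\<forall>\<xi>. (\<forall>\<eta>. (\<Sum>i\<in>UNIV. \<xi> $ i * (A *v \<eta>) $ i) = 0) \<longrightarrow> \<xi> = 0)"

end

theory Submission
  imports Defs
begin

text \<open>
  Write \<open>R\<close> for the ring of generalized numbers. It has zero divisors, so the equivalences do not come
  from linear algebra alone. Over any commutative ring, \<open>A\<close> is bijective iff \<open>det A\<close> is a unit, and
  McCoy's theorem says that \<open>A\<close> is injective iff \<open>det A\<close> is not a zero divisor. What makes the notions
  coincide over \<open>R\<close> is the dichotomy that every element of \<open>R\<close> is a unit or a zero divisor
  (\<open>colombeau_unit_or_zero_divisor\<close>). Non-degeneracy of \<open>A\<close> is injectivity of the transpose, which has
  the same determinant.

  McCoy's theorem enters as \<open>zero_divisor_det_imp_kernel\<close>: a determinant annihilated by some \<open>s \<noteq> 0\<close>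
  gives a nonzero vector in the kernel, made of cofactors.

  For the dichotomy, let \<open>r\<close> represent an element of \<open>R\<close>. If for some \<open>N\<close> the values
  \<open>norm (r (scale_fun \<epsilon> \<phi>))\<close> eventually exceed a positive multiple of \<open>\<epsilon> ^ N\<close>, for all \<open>\<phi>\<close> of order \<open>N\<close>,
  then \<open>1 / r\<close> is moderate and represents an inverse. If not, there are test objects \<open>\<Phi> N\<close> of every
  order \<open>N\<close> along which \<open>r\<close> is frequently of size \<open>\<epsilon> ^ N\<close> only, and the indicator function of these
  places should annihilate \<open>r\<close> without being negligible. The danger is that \<open>\<Phi> N\<close> with small \<open>N\<close> has a
  very high order: then \<open>r\<close> would be only moderately small at test objects of that order. A fixed test
  object cannot have this effect at all orders, because its order is finite
  (\<open>test_object_order_bounded\<close>): by Weierstrass approximation no continuous function of compact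
  support has the moments of the Dirac measure. The set of places is therefore cut off, for each \<open>N\<close>,
  at an order which \<open>\<Phi> N\<close> does not reach.
\<close>

section \<open>Determinants over a commutative ring\<close>

text \<open>
  The matrices \<open>unit_rows A f\<close> stand for the minors of \<open>A\<close>: up to sign, the determinant is zero or
  the minor of \<open>A\<close> that is left after deleting the rows \<open>i\<close> and the columns \<open>j\<close> with \<open>f i = Some j\<close>.
  The size of a minor thus becomes the number of rows with \<open>f i = None\<close>, and all minors are
  determinants of one matrix type.
\<close>

definition unit_rows :: "'a::comm_ring_1 ^ 'm ^ 'm \<Rightarrow> ('m \<Rightarrow> 'm option) \<Rightarrow> 'a ^ 'm ^ 'm" where
  "unit_rows A f = (\<chi> i. case f i of None \<Rightarrow> A $ i | Some j \<Rightarrow> axis j 1)"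

lemma det_replace_row_expansion:
  fixes M :: "'a::comm_ring_1 ^ 'm::finite ^ 'm"
  shows "det (\<chi> i. if i = k then v else M $ i) =
    (\<Sum>j\<in>UNIV. v $ j * det (\<chi> i. if i = k then axis j 1 else M $ i))"
proof -
  have "det (\<chi> i. if i = k then v else M $ i) =
      det (\<chi> i. if i = k then \<Sum>j\<in>UNIV. v $ j *s axis j 1 else M $ i)"
    by (simp only: basis_expansion)
  also have "\<dots> = (\<Sum>j\<in>UNIV. det (\<chi> i. if i = k then v $ j *s axis j 1 else M $ i))"
    by (simp add: det_linear_row_sum)
  also have "\<dots> = (\<Sum>j\<in>UNIV. v $ j * det (\<chi> i. if i = k then axis j 1 else M $ i))"
    by (simp add: det_row_mul)
  finally show ?thesis .
qed

lemma det_swap_rows: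
  fixes M :: "'a::comm_ring_1 ^ 'm::finite ^ 'm"
  assumes "k \<noteq> l"
  shows "det (\<chi> i. M $ Transposition.transpose k l i) = - det M"
  using assms det_permute_rows[OF permutes_swap_id[of k UNIV l], of M]
  by (simp add: sign_swap_id)

text \<open>
  The nontrivial half of McCoy's theorem. Choose a minor of maximal size that \<open>s\<close> does not
  annihilate: there is one, since the empty minor is 1, and it is not the full determinant. Enlarge
  it by one row \<open>k\<close>; the cofactors along this row, multiplied by \<open>s\<close>, are the entries of \<open>x\<close>. One of
  them is the chosen minor times \<open>s\<close>, so \<open>x \<noteq> 0\<close>. The product of row \<open>l\<close> of \<open>A\<close> with \<open>x\<close> is \<open>s\<close> times the
  determinant that has row \<open>l\<close> of \<open>A\<close> in position \<open>k\<close>: either two of its rows coincide, or it is, up to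
  sign, a larger minor, which \<open>s\<close> annihilates by maximality.
\<close>

lemma zero_divisor_det_imp_kernel:
  fixes A :: "'a::comm_ring_1 ^ 'm::finite ^ 'm"
  assumes s: "s \<noteq> 0" "s * det A = 0"
  shows "\<exists>x. x \<noteq> 0 \<and> A *v x = 0"
proof -
  define unit_count where "unit_count f = card {i. f i \<noteq> None}" for f :: "'m \<Rightarrow> 'm option"
  define survives where "survives f \<longleftrightarrow> s * det (unit_rows A f) \<noteq> 0" for f
  have "unit_rows A Some = mat 1"
    by (auto simp: unit_rows_def mat_def axis_def vec_eq_iff)
  then have "survives Some" using s by (simp add: survives_def)
  then obtain f where f: "survives f" and min: "\<And>g. unit_count g < unit_count f \<Longrightarrow> \<not> survives g"
    using ex_has_least_nat[of survives Some unit_count] by (metis not_le)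
  have "unit_rows A (\<lambda>_. None) = A"
    by (simp add: unit_rows_def vec_eq_iff)
  then have "f \<noteq> (\<lambda>_. None)" using f s by (auto simp: survives_def)
  then obtain k j where k: "f k = Some j" by fastforce
  define M where "M = unit_rows A f"
  define R where "R v = (\<chi> i. if i = k then v else M $ i)" for v
  define x where "x = (\<chi> j. s * det (R (axis j 1)))"
  have "R (axis j 1) = M"
    by (auto simp: R_def M_def unit_rows_def vec_eq_iff k)
  then have "x $ j \<noteq> 0" using f by (simp add: x_def survives_def M_def)
  then have "x \<noteq> 0" by auto
  moreover have "A *v x = 0"
  proof (rule vec_eq_iff[THEN iffD2, rule_format])
    fix l
    have "(A *v x) $ l = s * (\<Sum>j\<in>UNIV. A $ l $ j * det (R (axis j 1)))"
      by (simp add: matrix_vector_mult_def x_def sum_distrib_left algebra_simps)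
    also have "\<dots> = s * det (R (A $ l))"
      unfolding R_def det_replace_row_expansion[of k "A $ l" M] ..
    also have "\<dots> = 0"
    \<comment> \<open>For \<open>None\<close>, row \<open>l\<close> of \<open>A\<close> occurs in both positions \<open>k\<close> and \<open>l\<close>.\<close>
    proof (cases "f l")
      case None
      then have "l \<noteq> k" using k by auto
      then have "det (R (A $ l)) = 0"
        using None by (intro det_identical_rows[of l k])
          (auto simp: R_def M_def unit_rows_def row_def vec_eq_iff)
      then show ?thesis by simp
    next
      case (Some j')
      \<comment> \<open>One unit row fewer: the unit row at \<open>l\<close> moves to \<open>k\<close>, and position \<open>l\<close> returns to \<open>A\<close>.\<close>
      define g where "g = (f(k := f l))(l := None)"
      have "{i. g i \<noteq> None} = {i. f i \<noteq> None} - {l}"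
        using k Some by (auto simp: g_def)
      then have "unit_count g < unit_count f"
        using Some unfolding unit_count_def by (intro psubset_card_mono) auto
      then have "s * det (unit_rows A g) = 0"
        using min by (auto simp: survives_def)
      moreover have "det (R (A $ l)) = det (unit_rows A g) \<or> det (R (A $ l)) = - det (unit_rows A g)"
      proof (cases "l = k")
        case True
        then have "R (A $ l) = unit_rows A g"
          by (auto simp: R_def M_def unit_rows_def g_def vec_eq_iff)
        then show ?thesis by simp
      next
        case False
        then have "(\<chi> i. R (A $ l) $ Transposition.transpose k l i) = unit_rows A g"
          using Some by (auto simp: R_def M_def unit_rows_def g_def vec_eq_iff Transposition.transpose_def)
        then show ?thesis using det_swap_rows[of k l "R (A $ l)"] False by simp
      qed
      ultimately show ?thesis by auto
    qed
    finally show "(A *v x) $ l = 0 $ l" by simp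
  qed
  ultimately show ?thesis by blast
qed

text \<open>
  Cramer's rule in row form. Expanding row \<open>k\<close> by linearity leaves one term, because every other term
  repeats a row.
\<close>

lemma det_replace_row_combination:
  fixes A :: "'a::comm_ring_1 ^ 'm::finite ^ 'm"
  shows "det (\<chi> i. if i = k then \<Sum>j\<in>UNIV. x $ j *s A $ j else A $ i) = x $ k * det A"
proof -
  have "det (\<chi> i. if i = k then A $ j else A $ i) = (if j = k then det A else 0)" for j
  proof (cases "j = k")
    case True
    then have "(\<chi> i. if i = k then A $ j else A $ i) = A" by (auto simp: vec_eq_iff)
    then show ?thesis using True by simp
  next
    case False
    then show ?thesis
      by (auto intro!: det_identical_rows[of j k] simp: row_def vec_eq_iff)
  qed
  moreover have "det (\<chi> i. if i = k then \<Sum>j\<in>UNIV. x $ j *s A $ j else A $ i) =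
      (\<Sum>j\<in>UNIV. x $ j * det (\<chi> i. if i = k then A $ j else A $ i))"
    by (simp add: det_linear_row_sum det_row_mul)
  ultimately show ?thesis
    by (simp add: if_distrib[of "\<lambda>z. _ * z"] cong: if_cong)
qed

text \<open>
  The left inverse is the adjugate times the inverse of the determinant. The rows to be replaced are
  those of the transpose, so that the linear combination with coefficients \<open>x\<close> is \<open>A *v x\<close>.
\<close>

lemma left_inverse_of_unit_det:
  fixes A :: "'a::comm_ring_1 ^ 'm::finite ^ 'm"
  assumes "det A dvd 1"
  obtains B where "B ** A = mat 1"
proof -
  obtain d where d: "1 = det A * d" using assms by (rule dvdE)
  define T where "T = Finite_Cartesian_Product.transpose A"
  define B where "B = (\<chi> k j. d * det (\<chi> i. if i = k then axis j 1 else T $ i))"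
  have "B *v (A *v x) = x" for x
  proof (rule vec_eq_iff[THEN iffD2, rule_format])
    fix k
    have Ax: "A *v x = (\<Sum>j\<in>UNIV. x $ j *s T $ j)"
      by (simp add: T_def vec_eq_iff matrix_vector_mult_def Finite_Cartesian_Product.transpose_def mult.commute)
    have "(B *v (A *v x)) $ k = d * (\<Sum>j\<in>UNIV. (A *v x) $ j * det (\<chi> i. if i = k then axis j 1 else T $ i))"
      by (subst matrix_vector_mult_def) (simp add: B_def sum_distrib_left algebra_simps)
    also have "\<dots> = d * det (\<chi> i. if i = k then A *v x else T $ i)"
      by (simp only: det_replace_row_expansion[of k "A *v x" T])
    also have "\<dots> = d * (x $ k * det T)"
      by (simp only: Ax det_replace_row_combination)
    also have "\<dots> = x $ k"
    proof -
      have "d * (x $ k * det T) = x $ k * (det A * d)" by (simp add: T_def mult_ac)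
      then show ?thesis using d by simp
    qed
    finally show "(B *v (A *v x)) $ k = x $ k" .
  qed
  then have "B ** A = mat 1"
    by (simp add: matrix_eq matrix_vector_mul_assoc)
  then show ?thesis by (rule that)
qed

text \<open>
  Surjectivity alone gives a right inverse column by column, hence a unit determinant. Conversely a left
  inverse \<open>B\<close> of \<open>A\<close> again has a unit determinant, hence a left inverse \<open>C\<close>, and then \<open>C = A\<close>. This avoids
  a second, dual construction of the adjugate.
\<close>

lemma bij_iff_unit_det:
  fixes A :: "'a::comm_ring_1 ^ 'm::finite ^ 'm"
  shows "bij ((*v) A) \<longleftrightarrow> det A dvd 1"
proof
  assume "bij ((*v) A)"
  then have "\<forall>j. \<exists>x. A *v x = axis j 1" by (metis bij_pointE)
  then obtain c where c: "\<And>j. A *v c j = axis j 1" by metis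
  have "A ** (\<chi> i j. c j $ i) = mat 1"
  proof -
    have "(A ** (\<chi> i j. c j $ i)) $ i $ j = (A *v c j) $ i" for i j
      by (simp add: matrix_matrix_mult_def matrix_vector_mult_def)
    then show ?thesis by (auto simp: c vec_eq_iff mat_def axis_def)
  qed
  then have "1 = det A * det (\<chi> i j. c j $ i)" by (metis det_mul det_I)
  then show "det A dvd 1" by (rule dvdI)
next
  assume A: "det A dvd 1"
  then obtain B where B: "B ** A = mat 1" by (rule left_inverse_of_unit_det)
  then have "1 = det B * det A" by (metis det_mul det_I)
  then have "det B dvd 1" by (rule dvdI)
  then obtain C where C: "C ** B = mat 1" by (rule left_inverse_of_unit_det)
  have "C = A" by (metis B C matrix_mul_assoc matrix_mul_lid matrix_mul_rid)
  with B C show "bij ((*v) A)"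
    by (intro o_bij[of "(*v) B"]) (auto simp: fun_eq_iff matrix_vector_mul_assoc)
qed

lemma inj_matrix_iff_trivial_kernel:
  fixes A :: "'a::comm_ring_1 ^ 'm::finite ^ 'm"
  shows "inj ((*v) A) \<longleftrightarrow> (\<forall>x. A *v x = 0 \<longrightarrow> x = 0)"
proof
  assume "inj ((*v) A)"
  then show "\<forall>x. A *v x = 0 \<longrightarrow> x = 0" by (metis injD matrix_vector_mult_0_right)
next
  assume *: "\<forall>x. A *v x = 0 \<longrightarrow> x = 0"
  show "inj ((*v) A)"
  proof (rule injI)
    fix x y assume "A *v x = A *v y"
    then have "A *v (x - y) = 0" by (simp add: matrix_vector_mult_diff_distrib)
    then show "x = y" using * by fastforce
  qed
qed

lemma non_degenerate_iff_inj_transpose: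
  fixes A :: "'a::comm_ring_1 ^ 'm::finite ^ 'm"
  shows "non_degenerate A \<longleftrightarrow> inj ((*v) (Finite_Cartesian_Product.transpose A))"
proof -
  have eq: "(\<Sum>i\<in>UNIV. \<xi> $ i * (A *v \<eta>) $ i) =
      (\<Sum>j\<in>UNIV. (Finite_Cartesian_Product.transpose A *v \<xi>) $ j * \<eta> $ j)" for \<xi> \<eta>
    by (simp add: matrix_vector_mult_def Finite_Cartesian_Product.transpose_def
        sum_distrib_left sum_distrib_right algebra_simps) (rule sum.swap)
  have "(\<forall>\<eta>. (\<Sum>j\<in>UNIV. y $ j * \<eta> $ j) = 0) \<longleftrightarrow> y = 0" for y :: "'a ^ 'm"
  proof
    assume *: "\<forall>\<eta>. (\<Sum>j\<in>UNIV. y $ j * \<eta> $ j) = 0"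
    show "y = 0"
    proof (rule vec_eq_iff[THEN iffD2, rule_format])
      fix k
      show "y $ k = 0 $ k" using *[rule_format, of "axis k 1"]
        by (simp add: axis_def if_distrib[of "\<lambda>z. _ * z"] cong: if_cong)
    qed
  qed simp
  then show ?thesis
    unfolding non_degenerate_def inj_matrix_iff_trivial_kernel eq by simp
qed

text \<open>
  By McCoy's theorem, injectivity keeps \<open>det A\<close> from being a zero divisor. The hypothesis is exactly
  what turns this into invertibility of \<open>det A\<close>, as in a field or a finite ring.
\<close>

lemma inj_matrix_iff_unit_det:
  fixes A :: "'a::comm_ring_1 ^ 'm::finite ^ 'm"
  assumes "\<And>a::'a. a dvd 1 \<or> (\<exists>s. s \<noteq> 0 \<and> s * a = 0)"
  shows "inj ((*v) A) \<longleftrightarrow> det A dvd 1"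
  using assms[of "det A"] zero_divisor_det_imp_kernel[of _ A] bij_iff_unit_det[of A]
  by (metis bij_is_inj inj_matrix_iff_trivial_kernel)

section \<open>Moments of compactly supported functions\<close>

lemma monomial_Suc: "monomial (\<alpha>(i := Suc (\<alpha> i))) x = monomial \<alpha> x * x $ i"
proof -
  have "monomial (\<alpha>(i := Suc (\<alpha> i))) x = (\<Prod>j\<in>UNIV. x $ j ^ \<alpha> j * (if j = i then x $ i else 1))"
    unfolding monomial_def by (rule prod.cong) auto
  also have "\<dots> = monomial \<alpha> x * x $ i"
    by (simp add: prod.distrib monomial_def)
  finally show ?thesis .
qed

lemma monomial_zero: "monomial \<alpha> 0 = (if \<alpha> = (\<lambda>_. 0) then 1 else 0)"
  by (auto simp: monomial_def fun_eq_iff)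

lemma integrable_continuous_compact_support:
  fixes u :: "'a::euclidean_space \<Rightarrow> real"
  assumes "continuous_on UNIV u" "compact K" "\<And>x. x \<notin> K \<Longrightarrow> u x = 0" "continuous_on UNIV g"
  shows "integrable lborel (\<lambda>x. g x * u x)"
proof -
  have "integrable lborel (\<lambda>x. indicator K x *\<^sub>R (g x * u x))"
    by (intro borel_integrable_compact assms(2) continuous_intros continuous_on_subset[OF assms(1)]
        continuous_on_subset[OF assms(4)]) auto
  also have "(\<lambda>x. indicator K x *\<^sub>R (g x * u x)) = (\<lambda>x. g x * u x)"
    using assms(3) by (auto simp: indicator_def fun_eq_iff)
  finally show ?thesis .
qed

text \<open>
  Integration of \<open>g\<close> times a polynomial against \<open>u\<close> is evaluation at 0 times \<open>c\<close>, as for \<open>u = c \<delta>\<close>. The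
  monomial factor is part of the definition because the class of such \<open>g\<close> is then stable under
  multiplication by the coordinates, and so by all polynomials; a condition on \<open>g\<close> alone would not
  give control of products.
\<close>

definition dirac_moments ::
    "(real ^ 'n::finite \<Rightarrow> real) \<Rightarrow> real \<Rightarrow> (real ^ 'n \<Rightarrow> real) \<Rightarrow> bool" where
  "dirac_moments u c g \<longleftrightarrow> continuous_on UNIV g \<and>
     (\<forall>\<alpha>. (LINT x|lborel. (monomial \<alpha> x * g x) * u x) = monomial \<alpha> 0 * g 0 * c)"

context
  fixes u :: "real ^ 'n::finite \<Rightarrow> real" and K and c :: real
  assumes cont: "continuous_on UNIV u" and K: "compact K" "\<And>x. x \<notin> K \<Longrightarrow> u x = 0"
begin

lemma integrable_mult_compact_support: "continuous_on UNIV g \<Longrightarrow> integrable lborel (\<lambda>x. g x * u x)"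
  using integrable_continuous_compact_support[OF cont K(1)] K(2) by blast

lemma dirac_moments_add:
  assumes "dirac_moments u c g" "dirac_moments u c h"
  shows "dirac_moments u c (\<lambda>x. g x + h x)"
proof -
  have gh: "continuous_on UNIV g" "continuous_on UNIV h"
    using assms by (auto simp: dirac_moments_def)
  have int: "integrable lborel (\<lambda>x. (monomial \<alpha> x * f x) * u x)"
    if "continuous_on UNIV f" for f \<alpha>
    by (rule integrable_mult_compact_support) (intro continuous_intros continuous_on_monomial that)
  have "(LINT x|lborel. (monomial \<alpha> x * (g x + h x)) * u x) =
      (LINT x|lborel. (monomial \<alpha> x * g x) * u x) + (LINT x|lborel. (monomial \<alpha> x * h x) * u x)" for \<alpha>
    using Bochner_Integration.integral_add[OF int[OF gh(1)] int[OF gh(2)], of \<alpha> \<alpha>]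
    by (simp add: algebra_simps)
  then show ?thesis
    using assms by (auto simp: dirac_moments_def algebra_simps intro: continuous_on_add)
qed

lemma dirac_moments_cmult:
  assumes "dirac_moments u c g"
  shows "dirac_moments u c (\<lambda>x. a * g x)"
proof -
  have "(LINT x|lborel. (monomial \<alpha> x * (a * g x)) * u x) = a * (LINT x|lborel. (monomial \<alpha> x * g x) * u x)" for \<alpha>
    by (subst integral_mult_right_zero[symmetric]) (simp add: algebra_simps)
  then show ?thesis
    using assms by (auto simp: dirac_moments_def algebra_simps intro: continuous_on_mult_left)
qed

lemma dirac_moments_coordinate:
  assumes "dirac_moments u c g"
  shows "dirac_moments u c (\<lambda>x. x $ i * g x)"
proof -
  have cg: "continuous_on UNIV g"
    and g: "(LINT x|lborel. (monomial \<alpha> x * g x) * u x) = monomial \<alpha> 0 * g 0 * c" for \<alpha>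
    using assms by (auto simp: dirac_moments_def)
  have "(LINT x|lborel. (monomial \<alpha> x * (x $ i * g x)) * u x) = monomial \<alpha> 0 * (0 $ i * g 0) * c" for \<alpha>
    using g[of "\<alpha>(i := Suc (\<alpha> i))"] by (simp add: monomial_Suc mult.assoc)
  moreover have "continuous_on UNIV (\<lambda>x. x $ i * g x)"
    using cg by (intro continuous_intros)
  ultimately show ?thesis unfolding dirac_moments_def by blast
qed

lemma dirac_moments_sum:
  assumes "finite I" "\<And>i. i \<in> I \<Longrightarrow> dirac_moments u c (g i)"
  shows "dirac_moments u c (\<lambda>x. \<Sum>i\<in>I. g i x)"
  using assms
proof (induction I rule: finite_induct)
  case empty
  then show ?case by (simp add: dirac_moments_def)
next
  case (insert i I)
  then show ?case by (simp add: dirac_moments_add)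
qed

text \<open>
  The induction proves that \<open>p\<close> acts on the class rather than that \<open>p\<close> belongs to it, which makes the
  step for products immediate.
\<close>

lemma dirac_moments_polynomial:
  assumes "real_polynomial_function p"
  shows "dirac_moments u c g \<Longrightarrow> dirac_moments u c (\<lambda>x. p x * g x)"
  using assms
proof (induction p arbitrary: g rule: real_polynomial_function.induct)
  case (linear f)
  have f: "f x = (\<Sum>i\<in>UNIV. f (axis i 1) * x $ i)" for x
  proof -
    have "f x = f (\<Sum>i\<in>UNIV. x $ i *\<^sub>R axis i 1)"
      using basis_expansion[of x] by (simp add: scalar_mult_eq_scaleR)
    also have "\<dots> = (\<Sum>i\<in>UNIV. f (axis i 1) * x $ i)"
      using bounded_linear.linear[OF linear(1)]
      by (simp add: linear_sum linear_scale mult.commute)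
    finally show ?thesis .
  qed
  have "dirac_moments u c (\<lambda>x. \<Sum>i\<in>UNIV. f (axis i 1) * (x $ i * g x))"
    by (intro dirac_moments_sum dirac_moments_cmult dirac_moments_coordinate
        linear) simp
  also have "(\<lambda>x. \<Sum>i\<in>UNIV. f (axis i 1) * (x $ i * g x)) = (\<lambda>x. f x * g x)"
    by (subst f) (simp add: sum_distrib_right mult.assoc)
  finally show ?case .
next
  case (const a)
  then show ?case by (rule dirac_moments_cmult)
next
  case (add p q)
  then show ?case using dirac_moments_add by (auto simp: distrib_right)
next
  case (mult p q)
  then show ?case by (simp add: mult.assoc)
qed

text \<open>
  No function \<open>u\<close> can imitate \<open>c \<delta>\<close> on polynomials. By Weierstrass approximation on the compact support
  it would imitate it on all continuous functions, in particular on \<open>f x = (norm x)\<^sup>2 * u x\<close>. As \<open>f 0 = 0\<close>,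
  the integral of \<open>(norm x)\<^sup>2 * (u x)\<^sup>2\<close> is 0, so \<open>u\<close> vanishes almost everywhere.
\<close>

lemma AE_zero_if_moments_vanish:
  assumes mom: "\<And>\<alpha>. (LINT x|lborel. monomial \<alpha> x * u x) = monomial \<alpha> 0 * c"
  shows "AE x in lborel. u x = 0"
proof -
  have one: "dirac_moments u c (\<lambda>_. 1)"
    using mom by (simp add: dirac_moments_def)
  have poly: "(LINT x|lborel. p x * u x) = p 0 * c" if "real_polynomial_function p" for p
  proof -
    have "(LINT x|lborel. (monomial (\<lambda>_. 0) x * (p x * 1)) * u x) =
        monomial (\<lambda>_. 0) (0::real^'n) * (p 0 * 1) * c"
      using dirac_moments_polynomial[OF that one] unfolding dirac_moments_def by blast
    then show ?thesis by simp
  qed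
  define f where "f x = (norm x)\<^sup>2 * u x" for x
  have cf: "continuous_on UNIV f" unfolding f_def by (intro continuous_intros cont)
  note int = integrable_mult_compact_support
  have abs_u: "integrable lborel (\<lambda>x. \<bar>u x\<bar>)"
    using int[of "\<lambda>_. 1"] by simp
  have small: "\<bar>LINT x|lborel. f x * u x\<bar> \<le> e * ((LINT x|lborel. \<bar>u x\<bar>) + \<bar>c\<bar>)" if e: "e > 0" for e
  proof -
    \<comment> \<open>The point 0 is added to \<open>K\<close> so that \<open>p 0\<close> is close to \<open>f 0 = 0\<close>.\<close>
    obtain p where p: "real_polynomial_function p" "\<And>x. x \<in> insert 0 K \<Longrightarrow> \<bar>f x - p x\<bar> < e"
      using Stone_Weierstrass_real_polynomial_function[OF compact_insert[OF K(1)]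
          continuous_on_subset[OF cf subset_UNIV] e] by blast
    have cp: "continuous_on UNIV p"
      using p(1) continuous_on_polymonial_function real_polynomial_function_eq by blast
    have "(LINT x|lborel. f x * u x) - p 0 * c = (LINT x|lborel. (f x - p x) * u x)"
      using Bochner_Integration.integral_diff[OF int[OF cf] int[OF cp]] poly[OF p(1)]
      by (simp add: left_diff_distrib)
    also have "\<bar>\<dots>\<bar> \<le> (LINT x|lborel. e * \<bar>u x\<bar>)"
    proof (rule integral_abs_bound[THEN order_trans], rule integral_mono)
      show "integrable lborel (\<lambda>x. \<bar>(f x - p x) * u x\<bar>)"
        by (intro integrable_abs int continuous_intros cf cp)
      show "integrable lborel (\<lambda>x. e * \<bar>u x\<bar>)" using abs_u by simp
      show "\<bar>(f x - p x) * u x\<bar> \<le> e * \<bar>u x\<bar>" for x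
        using p(2)[of x] K(2)[of x] by (cases "x \<in> K") (auto simp: abs_mult intro!: mult_right_mono)
    qed
    finally have "\<bar>(LINT x|lborel. f x * u x) - p 0 * c\<bar> \<le> e * (LINT x|lborel. \<bar>u x\<bar>)"
      by simp
    moreover have "\<bar>p 0 * c\<bar> \<le> e * \<bar>c\<bar>"
      using p(2)[of 0] by (auto simp: abs_mult f_def intro!: mult_right_mono)
    ultimately show ?thesis by (simp add: distrib_left)
  qed
  have "\<bar>LINT x|lborel. f x * u x\<bar> \<le> 0"
  proof (rule field_le_epsilon)
    fix d :: real assume "d > 0"
    define C where "C = (LINT x|lborel. \<bar>u x\<bar>) + \<bar>c\<bar>"
    have "C \<ge> 0" unfolding C_def by (intro add_nonneg_nonneg integral_nonneg_AE) auto
    then have "d / (C + 1) * C \<le> d" using \<open>d > 0\<close> by (simp add: field_simps)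
    then show "\<bar>LINT x|lborel. f x * u x\<bar> \<le> 0 + d"
      using small[of "d / (C + 1)"] \<open>d > 0\<close> \<open>C \<ge> 0\<close> by (auto simp: C_def[symmetric])
  qed
  then have "(LINT x|lborel. f x * u x) = 0" by simp
  then have "AE x in lborel. f x * u x = 0"
    using integral_nonneg_eq_0_iff_AE[OF int[OF cf]]
    by (simp add: f_def mult.assoc zero_le_mult_iff)
  moreover have "AE x in lborel. x \<noteq> (0::real^'n)" by (rule AE_lborel_singleton)
  ultimately show ?thesis by eventually_elim (simp add: f_def)
qed

end

text \<open>
  A function in all the sets \<open>test_objects q\<close> would have the moments of \<open>\<delta>\<close>. Its real part would then
  vanish almost everywhere, whereas its integral is 1.
\<close>

lemma test_object_order_bounded:
  assumes \<phi>: "\<phi> \<in> test_objects 0"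
  shows "\<exists>q. \<phi> \<notin> test_objects q"
proof (rule ccontr)
  assume "\<not> ?thesis"
  then have all: "\<phi> \<in> test_objects q" for q by blast
  have tf: "\<phi> \<in> test_functions" and int1: "(LINT x|lborel. \<phi> x) = 1"
    using \<phi> by (auto simp: test_objects_def)
  obtain K where K: "smooth \<phi>" "compact K" "\<And>x. x \<notin> K \<Longrightarrow> \<phi> x = 0"
    using tf by (rule test_functionsE) blast
  define u where "u x = Re (\<phi> x)" for x
  have cont: "continuous_on UNIV u"
    unfolding u_def by (intro continuous_intros continuous_on_smooth K(1))
  have Re: "(LINT x|lborel. monomial \<alpha> x * u x) = Re (LINT x|lborel. monomial \<alpha> x *\<^sub>R \<phi> x)" for \<alpha>
    using integral_Re[OF integrable_monomial_test_function[OF tf, of \<alpha>]] by (simp add: u_def)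
  have "(LINT x|lborel. monomial \<alpha> x * u x) = monomial \<alpha> 0 * 1" for \<alpha>
  proof (cases "\<alpha> = (\<lambda>_. 0)")
    case True
    then show ?thesis using Re[of \<alpha>] int1 by simp
  next
    case False
    then obtain i where "\<alpha> i \<noteq> 0" by auto
    then have "1 \<le> (\<Sum>i\<in>UNIV. \<alpha> i)"
      using member_le_sum[of i UNIV \<alpha>] by fastforce
    then show ?thesis using all[of "\<Sum>i\<in>UNIV. \<alpha> i"] Re[of \<alpha>] False
      unfolding test_objects_def by (simp add: monomial_zero)
  qed
  then have "AE x in lborel. u x = 0"
    by (intro AE_zero_if_moments_vanish[OF cont K(2), where c=1]) (simp_all add: u_def K(3))
  then have "(LINT x|lborel. u x) = 0"
    by (rule integral_eq_zero_AE)
  then show False using Re[of "\<lambda>_. 0"] int1 by simp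
qed

section \<open>Units and zero divisors among the generalized numbers\<close>

text \<open>
  The radius recovers the scale from a test object: it turns \<open>\<epsilon>\<close>, a quantity attached to the pair of a
  test object and a parameter, into a function of the scaled test object alone, up to a constant
  factor. Conditions of the form \<open>norm (r (scale_fun \<epsilon> \<phi>)) \<le> \<epsilon> ^ N\<close> can so be read off from
  \<open>scale_fun \<epsilon> \<phi>\<close>.
\<close>

definition support_radius :: "(real ^ 'n::finite \<Rightarrow> complex) \<Rightarrow> real" where
  "support_radius \<phi> = Sup (norm ` {x. \<phi> x \<noteq> 0})"

lemma test_object_nonzero_point:
  fixes \<phi> :: "real ^ 'n::finite \<Rightarrow> complex"
  assumes "\<phi> \<in> test_objects q"
  obtains x where "x \<noteq> 0" "\<phi> x \<noteq> 0"
proof -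
  have "(LINT x|lborel. \<phi> x) = 1" using assms by (simp add: test_objects_def)
  moreover have "(LINT x|lborel. \<phi> x) = 0" if "\<And>x. x \<noteq> 0 \<Longrightarrow> \<phi> x = 0"
  proof (rule integral_eq_zero_AE)
    show "AE x in lborel. \<phi> x = 0"
      using AE_lborel_singleton[of "0::real^'n"] by eventually_elim (rule that)
  qed
  ultimately show ?thesis using that by fastforce
qed

lemma bdd_above_support:
  assumes "\<phi> \<in> test_functions"
  shows "bdd_above (norm ` {x. \<phi> x \<noteq> 0})"
proof -
  obtain K where K: "compact K" "\<And>x. x \<notin> K \<Longrightarrow> \<phi> x = 0"
    using assms by (rule test_functionsE) blast
  then have "bounded {x. \<phi> x \<noteq> 0}"
    by (meson bounded_subset compact_imp_bounded mem_Collect_eq subsetI)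
  then show ?thesis by (simp add: bounded_imp_bdd_above bounded_norm_comp)
qed

lemma support_radius_pos:
  assumes "\<phi> \<in> test_objects q"
  shows "support_radius \<phi> > 0"
proof -
  obtain x where x: "x \<noteq> 0" "\<phi> x \<noteq> 0"
    using assms by (rule test_object_nonzero_point)
  have "norm x \<le> support_radius \<phi>"
    unfolding support_radius_def using x assms
    by (intro cSup_upper bdd_above_support) (auto simp: test_objects_def)
  then show ?thesis using x(1) by (meson less_le_trans zero_less_norm_iff)
qed

lemma support_radius_scale_fun:
  fixes \<phi> :: "real ^ 'n::finite \<Rightarrow> complex"
  assumes \<phi>: "\<phi> \<in> test_objects q" and \<epsilon>: "\<epsilon> > 0"
  shows "support_radius (scale_fun \<epsilon> \<phi>) = \<epsilon> * support_radius \<phi>"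
proof -
  have bdd: "bdd_above (norm ` {x. \<phi> x \<noteq> 0})"
    using \<phi> by (intro bdd_above_support) (simp add: test_objects_def)
  obtain x0 where "\<phi> x0 \<noteq> 0" using \<phi> by (rule test_object_nonzero_point)
  then have ne: "norm ` {x. \<phi> x \<noteq> 0} \<noteq> {}" by blast
  have "{x. scale_fun \<epsilon> \<phi> x \<noteq> 0} = (\<lambda>x. \<epsilon> *\<^sub>R x) ` {x. \<phi> x \<noteq> 0}"
  proof (intro set_eqI iffI)
    fix x assume "x \<in> {x. scale_fun \<epsilon> \<phi> x \<noteq> 0}"
    then show "x \<in> (\<lambda>x. \<epsilon> *\<^sub>R x) ` {x. \<phi> x \<noteq> 0}"
      using \<epsilon> by (intro image_eqI[of _ _ "x /\<^sub>R \<epsilon>"]) (auto simp: scale_fun_def)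
  qed (use \<epsilon> in \<open>auto simp: scale_fun_def\<close>)
  then have "norm ` {x. scale_fun \<epsilon> \<phi> x \<noteq> 0} = (\<lambda>t. \<epsilon> * t) ` norm ` {x. \<phi> x \<noteq> 0}"
    using \<epsilon> by (auto simp: image_image)
  moreover have "Sup ((\<lambda>t. \<epsilon> * t) ` norm ` {x. \<phi> x \<noteq> 0}) = \<epsilon> * Sup (norm ` {x. \<phi> x \<noteq> 0})"
  proof (rule cSup_eq_non_empty)
    show "(\<lambda>t. \<epsilon> * t) ` norm ` {x. \<phi> x \<noteq> 0} \<noteq> {}" using ne by blast
  next
    fix t assume "t \<in> (\<lambda>t. \<epsilon> * t) ` norm ` {x. \<phi> x \<noteq> 0}"
    then show "t \<le> \<epsilon> * Sup (norm ` {x. \<phi> x \<noteq> 0})"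
      using \<epsilon> cSup_upper[OF _ bdd] by (auto intro!: mult_left_mono)
  next
    fix y assume y: "\<And>t. t \<in> (\<lambda>t. \<epsilon> * t) ` norm ` {x. \<phi> x \<noteq> 0} \<Longrightarrow> t \<le> y"
    have "Sup (norm ` {x. \<phi> x \<noteq> 0}) \<le> y / \<epsilon>"
    proof (rule cSup_least[OF ne])
      fix t assume "t \<in> norm ` {x. \<phi> x \<noteq> 0}"
      then have "\<epsilon> * t \<le> y" by (intro y) blast
      then show "t \<le> y / \<epsilon>" using \<epsilon> by (simp add: field_simps)
    qed
    then show "\<epsilon> * Sup (norm ` {x. \<phi> x \<noteq> 0}) \<le> y" using \<epsilon> by (simp add: field_simps)
  qed
  ultimately show ?thesis by (simp add: support_radius_def)
qed

text \<open>
  Two representatives that agree for all small \<open>\<epsilon>\<close>, for each test object of sufficient order,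
  define the same generalized number. The threshold for \<open>\<epsilon>\<close> may depend on the test object.
\<close>

lemma colombeau_rel_eventually:
  assumes "r \<in> moderate" "s \<in> moderate"
    and "\<And>\<phi>. \<phi> \<in> test_objects q \<Longrightarrow> \<forall>\<^sub>F \<epsilon> in at_right 0. r (scale_fun \<epsilon> \<phi>) = s (scale_fun \<epsilon> \<phi>)"
  shows "colombeau_rel r s"
proof -
  have "(\<lambda>\<phi>. r \<phi> - s \<phi>) \<in> null_functions"
    unfolding null_functions_def
  proof (intro CollectI allI impI exI[of _ "Suc q"] conjI ballI)
    fix m :: nat and \<phi> :: "real ^ 'a \<Rightarrow> complex"
    assume "\<phi> \<in> test_objects (Suc q)"
    then have "\<phi> \<in> test_objects q" using test_objects_antimono[of q "Suc q"] by auto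
    from assms(3)[OF this]
    have "\<forall>\<^sub>F \<epsilon> in at_right 0. norm (r (scale_fun \<epsilon> \<phi>) - s (scale_fun \<epsilon> \<phi>)) = 0"
      by eventually_elim simp
    from landau_o.big.in_cong[OF this]
    show "(\<lambda>\<epsilon>. norm (r (scale_fun \<epsilon> \<phi>) - s (scale_fun \<epsilon> \<phi>))) \<in> O[at_right 0](\<lambda>\<epsilon>. \<epsilon> ^ m)"
      by simp
  qed simp
  then show ?thesis using assms by (simp add: colombeau_rel_def)
qed

text \<open>
  The order \<open>N\<close> of the lower bound has to be uniform in \<open>\<phi>\<close>, because moderateness of the inverse asks
  for one exponent. Zeros of \<open>r\<close> are harmless: they do not occur at \<open>scale_fun \<epsilon> \<phi>\<close> for small \<open>\<epsilon>\<close>, and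
  elsewhere \<open>inverse 0 = 0\<close> does no damage.
\<close>

lemma inverse_if_bounded_below:
  fixes r :: "(real ^ 'n::finite \<Rightarrow> complex) \<Rightarrow> complex"
  assumes r: "r \<in> moderate"
    and N: "\<And>\<phi>. \<phi> \<in> test_objects N \<Longrightarrow>
      \<forall>\<^sub>F \<epsilon> in at_right 0. support_radius (scale_fun \<epsilon> \<phi>) ^ N < norm (r (scale_fun \<epsilon> \<phi>))"
  shows "(\<lambda>\<phi>. inverse (r \<phi>)) \<in> moderate" "colombeau_rel (\<lambda>\<phi>. r \<phi> * inverse (r \<phi>)) (\<lambda>_. 1)"
proof -
  have pos: "\<forall>\<^sub>F \<epsilon> in at_right (0::real). \<epsilon> > 0" by (rule eventually_at_right_less)
  show mod: "(\<lambda>\<phi>. inverse (r \<phi>)) \<in> moderate"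
  proof (rule moderateI[of N])
    fix \<phi> :: "real ^ 'n \<Rightarrow> complex" assume \<phi>: "\<phi> \<in> test_objects N"
    note \<rho> = support_radius_pos[OF \<phi>]
    show "(\<lambda>\<epsilon>. norm (inverse (r (scale_fun \<epsilon> \<phi>)))) \<in> O[at_right 0](\<lambda>\<epsilon>. inverse (\<epsilon> ^ N))"
    proof (rule bigoI[where c = "inverse (support_radius \<phi> ^ N)"])
      show "\<forall>\<^sub>F \<epsilon> in at_right 0. norm (norm (inverse (r (scale_fun \<epsilon> \<phi>))))
          \<le> inverse (support_radius \<phi> ^ N) * norm (inverse (\<epsilon> ^ N))"
        using N[OF \<phi>] pos
      proof eventually_elim
        case (elim \<epsilon>)
        have "inverse (norm (r (scale_fun \<epsilon> \<phi>))) \<le> inverse ((\<epsilon> * support_radius \<phi>) ^ N)"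
          using elim \<rho> support_radius_scale_fun[OF \<phi>, of \<epsilon>] by (intro le_imp_inverse_le) auto
        then show ?case using elim by (simp add: norm_inverse power_mult_distrib mult.commute)
      qed
    qed
  qed
  show "colombeau_rel (\<lambda>\<phi>. r \<phi> * inverse (r \<phi>)) (\<lambda>_. 1)"
  proof (rule colombeau_rel_eventually[of _ _ N])
    fix \<phi> :: "real ^ 'n \<Rightarrow> complex" assume \<phi>: "\<phi> \<in> test_objects N"
    show "\<forall>\<^sub>F \<epsilon> in at_right 0. r (scale_fun \<epsilon> \<phi>) * inverse (r (scale_fun \<epsilon> \<phi>)) = 1"
      using N[OF \<phi>] pos
    proof eventually_elim
      case (elim \<epsilon>)
      then have "0 < norm (r (scale_fun \<epsilon> \<phi>))"
        using support_radius_pos[OF scale_fun_test_objects[OF \<phi>, of \<epsilon>]]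
        by (meson less_trans zero_less_power)
      then show ?case by simp
    qed
  qed (intro moderate_intros r mod)+
qed

text \<open>
  The annihilator \<open>s\<close> is the indicator function of a set \<open>E\<close> on which \<open>r\<close> is small. Let \<open>\<Phi> N\<close> be a test
  object of order \<open>N\<close> along which \<open>r\<close> is repeatedly as small as the \<open>N\<close>-th power of the scale. The set \<open>E\<close>
  has to contain these points for every \<open>N\<close>, so that \<open>s\<close> is not negligible. Yet for \<open>s * r\<close> to be
  negligible, only points where \<open>r\<close> is of order at least \<open>m\<close> may remain in \<open>E\<close> once test objects have
  sufficiently high order. Both demands are compatible because \<open>\<Phi> N\<close> has finite order: the \<open>N\<close>-th
  condition is imposed only on test objects of order below \<open>h N\<close>, so that orders beyond
  all \<open>h N\<close> with \<open>N < m\<close> leave just the conditions with \<open>N \<ge> m\<close>.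
\<close>

lemma annihilator_if_not_bounded_below:
  fixes r :: "(real ^ 'n::finite \<Rightarrow> complex) \<Rightarrow> complex"
  assumes small: "\<And>N. \<exists>\<phi>\<in>test_objects N.
      \<exists>\<^sub>F \<epsilon> in at_right 0. norm (r (scale_fun \<epsilon> \<phi>)) \<le> support_radius (scale_fun \<epsilon> \<phi>) ^ N"
  shows "\<exists>s. s \<in> moderate \<and> s \<notin> null_functions \<and> (\<lambda>\<phi>. s \<phi> * r \<phi>) \<in> null_functions"
proof -
  obtain \<Phi> where \<Phi>: "\<And>N. \<Phi> N \<in> test_objects N"
    and freq: "\<And>N. \<exists>\<^sub>F \<epsilon> in at_right 0.
      norm (r (scale_fun \<epsilon> (\<Phi> N))) \<le> support_radius (scale_fun \<epsilon> (\<Phi> N)) ^ N"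
    using small by metis
  have "\<exists>q. \<Phi> N \<notin> test_objects q" for N
    using \<Phi>[of N] test_objects_antimono[of 0 N] by (intro test_object_order_bounded) auto
  then obtain h where h: "\<And>N. \<Phi> N \<notin> test_objects (h N)" by metis
  define E where "E = {\<psi>. \<exists>N. \<psi> \<notin> test_objects (h N) \<and> norm (r \<psi>) \<le> support_radius \<psi> ^ N}"
  define s :: "(real ^ 'n \<Rightarrow> complex) \<Rightarrow> complex" where "s = indicator E"
  have pos: "\<forall>\<^sub>F \<epsilon> in at_right (0::real). \<epsilon> > 0" by (rule eventually_at_right_less)
  have "s \<in> moderate"
    by (rule moderateI[of 0], rule bigoI[where c=1]) (simp add: s_def indicator_def)
  moreover have "s \<notin> null_functions"
  proof
    assume "s \<in> null_functions"
    then obtain q where "\<And>\<phi>. \<phi> \<in> test_objects q \<Longrightarrow>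
        (\<lambda>\<epsilon>. norm (s (scale_fun \<epsilon> \<phi>))) \<in> O[at_right 0](\<lambda>\<epsilon>. \<epsilon> ^ 1)"
      unfolding null_functions_def by blast
    from this[OF \<Phi>] obtain c where c: "c > 0"
      and bound: "\<forall>\<^sub>F \<epsilon> in at_right 0. norm (norm (s (scale_fun \<epsilon> (\<Phi> q)))) \<le> c * norm (\<epsilon> ^ 1)"
      by (rule landau_o.bigE)
    have "\<forall>\<^sub>F \<epsilon> in at_right (0::real). \<epsilon> \<in> {0<..<1 / c}"
      using c by (intro eventually_at_right_real) auto
    with bound have "\<forall>\<^sub>F \<epsilon> in at_right 0.
        \<not> norm (r (scale_fun \<epsilon> (\<Phi> q))) \<le> support_radius (scale_fun \<epsilon> (\<Phi> q)) ^ q"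
    proof eventually_elim
      case (elim \<epsilon>)
      then have "0 < \<epsilon>" and "c * \<epsilon> < 1" using c by (auto simp: field_simps)
      with elim have "s (scale_fun \<epsilon> (\<Phi> q)) \<noteq> 1" by auto
      then have "scale_fun \<epsilon> (\<Phi> q) \<notin> E" by (auto simp: s_def)
      \<comment> \<open>Scaling preserves the order in both directions, since it can be undone.\<close>
      moreover have "scale_fun \<epsilon> (\<Phi> q) \<notin> test_objects (h q)"
      proof
        assume "scale_fun \<epsilon> (\<Phi> q) \<in> test_objects (h q)"
        then have "scale_fun (inverse \<epsilon>) (scale_fun \<epsilon> (\<Phi> q)) \<in> test_objects (h q)"
          using \<open>0 < \<epsilon>\<close> by (intro scale_fun_test_objects[OF \<open>scale_fun \<epsilon> (\<Phi> q) \<in> test_objects (h q)\<close>]) auto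
        moreover have "scale_fun (inverse \<epsilon>) (scale_fun \<epsilon> (\<Phi> q)) = \<Phi> q"
          using \<open>0 < \<epsilon>\<close> by (simp add: scale_fun_def fun_eq_iff power_inverse)
        ultimately show False using h[of q] by simp
      qed
      ultimately show ?case by (auto simp: E_def)
    qed
    then show False using freq[of q] by (simp add: frequently_def)
  qed
  moreover have "(\<lambda>\<phi>. s \<phi> * r \<phi>) \<in> null_functions"
    unfolding null_functions_def
  proof (intro CollectI allI impI)
    fix m :: nat
    \<comment> \<open>The sum is a convenient bound for all \<open>h N\<close> with \<open>N < m\<close>; \<open>Suc\<close> makes it positive.\<close>
    define q where "q = Suc (\<Sum>N<m. h N)"
    have hq: "h N \<le> q" if "N < m" for N
      using that member_le_sum[of N "{..<m}" h] by (simp add: q_def)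
    have "(\<lambda>\<epsilon>. norm (s (scale_fun \<epsilon> \<phi>) * r (scale_fun \<epsilon> \<phi>))) \<in> O[at_right 0](\<lambda>\<epsilon>. \<epsilon> ^ m)"
      if \<phi>: "\<phi> \<in> test_objects q" for \<phi>
    proof (rule bigoI[where c = "support_radius \<phi> ^ m"])
      note \<rho> = support_radius_pos[OF \<phi>]
      have "\<forall>\<^sub>F \<epsilon> in at_right (0::real). \<epsilon> \<in> {0<..<1 / support_radius \<phi>}"
        using \<rho> by (intro eventually_at_right_real) auto
      then show "\<forall>\<^sub>F \<epsilon> in at_right 0. norm (norm (s (scale_fun \<epsilon> \<phi>) * r (scale_fun \<epsilon> \<phi>)))
          \<le> support_radius \<phi> ^ m * norm (\<epsilon> ^ m)"
      proof eventually_elim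
        case (elim \<epsilon>)
        then have \<epsilon>: "0 < \<epsilon>" "\<epsilon> * support_radius \<phi> \<le> 1"
          using \<rho> by (auto simp: field_simps)
        show ?case
        proof (cases "scale_fun \<epsilon> \<phi> \<in> E")
          case True
          then obtain N where N: "scale_fun \<epsilon> \<phi> \<notin> test_objects (h N)"
              "norm (r (scale_fun \<epsilon> \<phi>)) \<le> (\<epsilon> * support_radius \<phi>) ^ N"
            using support_radius_scale_fun[OF \<phi> \<epsilon>(1)] by (auto simp: E_def)
          have "\<not> N < m"
            using N(1) scale_fun_test_objects[OF \<phi> \<epsilon>(1)] test_objects_antimono[OF hq] by blast
          then have "(\<epsilon> * support_radius \<phi>) ^ N \<le> (\<epsilon> * support_radius \<phi>) ^ m"
            using \<epsilon> \<rho> by (intro power_decreasing) auto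
          with N(2) have "norm (r (scale_fun \<epsilon> \<phi>)) \<le> (\<epsilon> * support_radius \<phi>) ^ m" by linarith
          then show ?thesis
            using True \<epsilon>(1) by (simp add: s_def power_mult_distrib mult.commute)
        next
          case False
          then show ?thesis using \<rho> by (simp add: s_def)
        qed
      qed
    qed
    then show "\<exists>q\<ge>1. \<forall>\<phi>\<in>test_objects q.
        (\<lambda>\<epsilon>. norm (s (scale_fun \<epsilon> \<phi>) * r (scale_fun \<epsilon> \<phi>))) \<in> O[at_right 0](\<lambda>\<epsilon>. \<epsilon> ^ m)"
      by (intro exI[of _ q]) (simp add: q_def)
  qed
  ultimately show ?thesis by blast
qed

text \<open>
  Either \<open>r\<close> is bounded below by a fixed power of the scale, or such a bound fails for every exponent;
  the two preceding lemmas treat the two cases.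
\<close>

lemma colombeau_unit_or_zero_divisor:
  fixes a :: "'n::finite colombeau_number"
  shows "a dvd 1 \<or> (\<exists>s. s \<noteq> 0 \<and> s * a = 0)"
  unfolding dvd_def
proof (transfer)
  fix r :: "(real ^ 'n \<Rightarrow> complex) \<Rightarrow> complex"
  assume "colombeau_rel r r"
  then have r: "r \<in> moderate" by (rule colombeau_relD1)
  show "(\<exists>t\<in>Collect (\<lambda>t. colombeau_rel t t). colombeau_rel (\<lambda>_. 1) (\<lambda>\<phi>. r \<phi> * t \<phi>)) \<or>
    (\<exists>s\<in>Collect (\<lambda>t. colombeau_rel t t). \<not> colombeau_rel s (\<lambda>_. 0) \<and> colombeau_rel (\<lambda>\<phi>. s \<phi> * r \<phi>) (\<lambda>_. 0))"
  proof (cases "\<exists>N. \<forall>\<phi>\<in>test_objects N.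
      \<forall>\<^sub>F \<epsilon> in at_right 0. support_radius (scale_fun \<epsilon> \<phi>) ^ N < norm (r (scale_fun \<epsilon> \<phi>))")
    case True
    then obtain N where "\<And>\<phi>. \<phi> \<in> test_objects N \<Longrightarrow>
      \<forall>\<^sub>F \<epsilon> in at_right 0. support_radius (scale_fun \<epsilon> \<phi>) ^ N < norm (r (scale_fun \<epsilon> \<phi>))"
      by blast
    note inv = inverse_if_bounded_below[OF r this]
    have "colombeau_rel (\<lambda>_. 1) (\<lambda>\<phi>. r \<phi> * inverse (r \<phi>))"
      using inv(2) part_equivp_symp[OF part_equivp_colombeau_rel] by blast
    moreover have "colombeau_rel (\<lambda>\<phi>. inverse (r \<phi>)) (\<lambda>\<phi>. inverse (r \<phi>))"
      using inv(1) by (intro colombeau_relI) auto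
    ultimately show ?thesis
      by (intro disjI1 bexI[of _ "\<lambda>\<phi>. inverse (r \<phi>)"]) simp_all
  next
    case False
    then have "\<exists>\<phi>\<in>test_objects N.
      \<exists>\<^sub>F \<epsilon> in at_right 0. norm (r (scale_fun \<epsilon> \<phi>)) \<le> support_radius (scale_fun \<epsilon> \<phi>) ^ N" for N
      by (simp add: not_eventually not_less)
    then obtain s where s: "s \<in> moderate" "s \<notin> null_functions"
        "(\<lambda>\<phi>. s \<phi> * r \<phi>) \<in> null_functions"
      using annihilator_if_not_bounded_below[of r] by blast
    have "colombeau_rel s s" using s(1) by (intro colombeau_relI) auto
    moreover have "\<not> colombeau_rel s (\<lambda>_. 0)" using s(2) by (simp add: colombeau_rel_def)
    moreover have "colombeau_rel (\<lambda>\<phi>. s \<phi> * r \<phi>) (\<lambda>_. 0)"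
      using s r by (simp add: colombeau_rel_def moderate_mult moderate_const)
    ultimately show ?thesis
      by (intro disjI2 bexI[of _ s]) simp_all
  qed
qed

section \<open>Matrices of generalized numbers\<close>

theorem proposition20:
  fixes A :: "'n::finite colombeau_number ^ 'm::finite ^ 'm"
  shows "(non_degenerate A \<longleftrightarrow> inj ((*v) A)) \<and>
         (inj ((*v) A) \<longleftrightarrow> bij ((*v) A)) \<and>
         (bij ((*v) A) \<longleftrightarrow> det A dvd 1)"
proof -
  have "inj ((*v) B) \<longleftrightarrow> det B dvd 1" for B :: "'n colombeau_number ^ 'm ^ 'm"
    by (rule inj_matrix_iff_unit_det) (rule colombeau_unit_or_zero_divisor)
  then show ?thesis
    by (simp add: non_degenerate_iff_inj_transpose bij_iff_unit_det)
qed

end
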